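(* Let $K$ be a finite field, let $S=K[t_1,\ldots,t_s]$, let $X=\{P_1,\ldots,P_m\}$ be a subset of $K^s$ with $|X|\geq 2$, let $I=I(X)$ be its vanishing ideal, let $r_0$ be the regularity index of $H_I^a$, and let $\prec$ be a graded monomial order on $S$. If $I$ is Gorenstein, then there is $g\in K\Delta_\prec(I)$ such that $g(P_i)\neq 0$ for all $i$ and $$(g(P_1),\ldots,g(P_m))\cdot C_X(r_0-d-1)=C_X(d)^\perp\quad\text{for all integers } -1\leq d\leq r_0.$$ Moreover, one can choose $g=\sum_{i=1}^m\mathrm{lc}(f_i)f_i$, where $f_i$ is the $i$-th standard indicator function and $\mathrm{lc}(f_i)$ is its leading coefficient.
   Context: $I(X)$ is the ideal of all polynomials vanishing on $X$. A graded monomial order compares monomials first by total degree; leading coefficients are with respect to $\prec$. $\Delta_\prec(I)$ is the set of standard monomials of $S/I$ (monomials not in $\mathrm{in}_\prec(I)$), and $K\Delta_\prec(I)$ is its $K$-span. The $i$-th standard indicator function $f_i$ is the unique polynomial in $K\Delta_\prec(I)$ with $f_i(P_i)=1$ and $f_i(P_j)=0$ for $j\neq i$. For $d\ge 0$, $S_{\le d}$ is the space of polynomials of total degree at most $d$; $S_{\le -1}=\{0\}$; $I_{\le d}=I\cap S_{\le d}$; $H_I^a(d)=\dim_K(S_{\le d}/I_{\le d})$. The regularity index $r_0$ of $H_I^a$ is the least integer $\ell\ge 0$ with $H_I^a(d)=|X|$ for all $d\ge\ell$. $C_X(d)=\{(f(P_1),\ldots,f(P_m)): f\in S_{\le d}\}\subset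 K^m$ is the Reed--Muller-type code of degree $d$. For a linear code $C\subset K^m$, $C^\perp$ is the dual for the ordinary inner product, and $\beta\cdot C=\{(\beta_1c_1,\ldots,\beta_mc_m): c\in C\}$. Gorenstein convention: let $u$ be a new variable; for $f\in S$ of degree $e$ let $f^h=u^e f(t_1/u,\ldots,t_s/u)$, and let $I^h=(\{f^h: f\in I\})\subset S[u]$ (standard grading). $I=I(X)$ is called Gorenstein if $S[u]/I^h$ is a Gorenstein graded ring, i.e. it is Cohen--Macaulay and the last Betti number in its minimal graded free resolution over $S[u]$ equals $1$. *)

theory Defs
  imports
    "HOL-Library.Poly_Mapping"
    "HOL-Library.Extended_Nat"
    "Jordan_Normal_Form.Matrix_Kernel"
begin

section \<open>Polynomials\<close>

text \<open>A monomial in variables indexed by \<^typ>\<open>'v\<close> is its exponent vector. A polynomial ring in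
  finitely many variables is given by a type \<^typ>\<open>'v\<close> of class \<^class>\<open>finite\<close>, so the number of
  variables is the (arbitrary) cardinality of that type.\<close>

type_synonym 'v mon = "'v \<Rightarrow>\<^sub>0 nat"
type_synonym ('v, 'a) mpoly = "'v mon \<Rightarrow>\<^sub>0 'a"

definition mon_deg :: "'v::finite mon \<Rightarrow> nat" where
  "mon_deg a = (\<Sum>i\<in>UNIV. Poly_Mapping.lookup a i)"

definition scale :: "'a::field \<Rightarrow> ('v, 'a) mpoly \<Rightarrow> ('v, 'a) mpoly" where
  "scale c f = Poly_Mapping.single 0 c * f"

interpretation mpoly: vector_space "scale :: 'a::field \<Rightarrow> ('v, 'a) mpoly \<Rightarrow> _"
proof
  fix a b :: 'a and x y :: "('v, 'a) mpoly"
  show "scale a (x + y) = scale a x + scale a y"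
    by (simp add: scale_def distrib_left)
  show "scale (a + b) x = scale a x + scale b x"
    by (simp add: scale_def single_add distrib_right)
  show "scale a (scale b x) = scale (a * b) x"
    by (simp add: scale_def mult.assoc [symmetric] mult_single)
  show "scale 1 x = x"
    by (simp add: scale_def)
qed

text \<open>The submodules of a commutative ring over itself are its ideals:
  \<open>ring_ideal.subspace\<close> is the predicate of being an ideal and \<open>ring_ideal.span\<close>
  the ideal generated by a set.\<close>

interpretation ring_ideal: Modules.module "(*) :: 'r::comm_ring_1 \<Rightarrow> 'r \<Rightarrow> 'r"
  by standard (simp_all add: algebra_simps)

definition peval :: "('v::finite, 'a::comm_ring_1) mpoly \<Rightarrow> ('v \<Rightarrow> 'a) \<Rightarrow> 'a" where
  "peval f x =
     (\<Sum>a\<in>Poly_Mapping.keys f.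
        Poly_Mapping.lookup f a * (\<Prod>i\<in>UNIV. x i ^ Poly_Mapping.lookup a i))"

definition vanishing_ideal :: "('v::finite \<Rightarrow> 'a::comm_ring_1) set \<Rightarrow> ('v, 'a) mpoly set" where
  "vanishing_ideal X = {f. \<forall>x\<in>X. peval f x = 0}"

text \<open>Integer degree bound, so that for negative \<open>d\<close> the space is \<open>{0}\<close>.\<close>

definition polys_le :: "int \<Rightarrow> ('v::finite, 'a::zero) mpoly set" where
  "polys_le d = {f. \<forall>a\<in>Poly_Mapping.keys f. int (mon_deg a) \<le> d}"

definition total_deg :: "('v::finite, 'a::zero) mpoly \<Rightarrow> nat" where
  "total_deg f = (if f = 0 then 0 else Max (mon_deg ` Poly_Mapping.keys f))"

section \<open>Affine Hilbert function and regularity index\<close>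

text \<open>\<open>basis_modulo V W B\<close>: the classes of the elements of \<open>B\<close> are pairwise distinct and form a
  \<open>K\<close>-basis of \<open>V / W\<close>.\<close>

definition basis_modulo ::
  "('v, 'a::field) mpoly set \<Rightarrow> ('v, 'a) mpoly set \<Rightarrow> ('v, 'a) mpoly set \<Rightarrow> bool" where
  "basis_modulo V W B \<longleftrightarrow> finite B \<and> B \<subseteq> V \<and>
     (\<forall>f\<in>V. \<exists>c. f - (\<Sum>b\<in>B. scale (c b) b) \<in> W) \<and>
     (\<forall>c. (\<Sum>b\<in>B. scale (c b) b) \<in> W \<longrightarrow> (\<forall>b\<in>B. c b = 0))"

definition quot_dim :: "('v, 'a::field) mpoly set \<Rightarrow> ('v, 'a) mpoly set \<Rightarrow> nat" where
  "quot_dim V W = (THE n. \<exists>B. basis_modulo V W B \<and> card B = n)"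

definition affine_hilbert :: "('v::finite, 'a::field) mpoly set \<Rightarrow> int \<Rightarrow> nat" where
  "affine_hilbert I d = quot_dim (polys_le d) (I \<inter> polys_le d)"

definition regularity_index :: "('v::finite \<Rightarrow> 'a::field) set \<Rightarrow> nat" where
  "regularity_index X =
     (LEAST l. \<forall>d\<ge>l. affine_hilbert (vanishing_ideal X) (int d) = card X)"

section \<open>Graded monomial orders and standard indicator functions\<close>

text \<open>\<open>prec\<close> is the strict order.\<close>

definition monomial_order :: "('v mon \<Rightarrow> 'v mon \<Rightarrow> bool) \<Rightarrow> bool" where
  "monomial_order prec \<longleftrightarrow>
     irreflp prec \<and> transp prec \<and> totalp prec \<and>
     (\<forall>a. a \<noteq> 0 \<longrightarrow> prec 0 a) \<and>
     (\<forall>a b c. prec a b \<longrightarrow> prec (a + c) (b + c))"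

definition graded_monomial_order :: "('v::finite mon \<Rightarrow> 'v mon \<Rightarrow> bool) \<Rightarrow> bool" where
  "graded_monomial_order prec \<longleftrightarrow>
     monomial_order prec \<and> (\<forall>a b. mon_deg a < mon_deg b \<longrightarrow> prec a b)"

text \<open>Only meaningful for nonzero polynomials.\<close>

definition lead_mon :: "('v mon \<Rightarrow> 'v mon \<Rightarrow> bool) \<Rightarrow> ('v, 'a::zero) mpoly \<Rightarrow> 'v mon" where
  "lead_mon prec f =
     (THE a. a \<in> Poly_Mapping.keys f \<and> (\<forall>b\<in>Poly_Mapping.keys f. b \<noteq> a \<longrightarrow> prec b a))"

definition lead_coef :: "('v mon \<Rightarrow> 'v mon \<Rightarrow> bool) \<Rightarrow> ('v, 'a::zero) mpoly \<Rightarrow> 'a" where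
  "lead_coef prec f = Poly_Mapping.lookup f (lead_mon prec f)"

definition initial_ideal ::
  "('v mon \<Rightarrow> 'v mon \<Rightarrow> bool) \<Rightarrow> ('v, 'a::field) mpoly set \<Rightarrow> ('v, 'a) mpoly set" where
  "initial_ideal prec I =
     ring_ideal.span ((\<lambda>f. Poly_Mapping.single (lead_mon prec f) 1) ` (I - {0}))"

definition standard_monomials ::
  "('v mon \<Rightarrow> 'v mon \<Rightarrow> bool) \<Rightarrow> ('v, 'a::field) mpoly set \<Rightarrow> ('v, 'a) mpoly set" where
  "standard_monomials prec I =
     {Poly_Mapping.single a 1 | a. Poly_Mapping.single a 1 \<notin> initial_ideal prec I}"

definition standard_span ::
  "('v mon \<Rightarrow> 'v mon \<Rightarrow> bool) \<Rightarrow> ('v, 'a::field) mpoly set \<Rightarrow> ('v, 'a) mpoly set" where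
  "standard_span prec I = mpoly.span (standard_monomials prec I)"

text \<open>Points are listed as \<open>P 0, \<dots>, P (m - 1)\<close>.\<close>

definition standard_indicator ::
  "('v mon \<Rightarrow> 'v mon \<Rightarrow> bool) \<Rightarrow> (nat \<Rightarrow> 'v::finite \<Rightarrow> 'a::field) \<Rightarrow> nat \<Rightarrow> nat \<Rightarrow> ('v, 'a) mpoly" where
  "standard_indicator prec P m i =
     (THE f. f \<in> standard_span prec (vanishing_ideal (P ` {..<m})) \<and>
        peval f (P i) = 1 \<and> (\<forall>j<m. j \<noteq> i \<longrightarrow> peval f (P j) = 0))"

section \<open>Reed--Muller-type codes\<close>

definition eval_code :: "(nat \<Rightarrow> 'v::finite \<Rightarrow> 'a::field) \<Rightarrow> nat \<Rightarrow> int \<Rightarrow> 'a vec set" where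
  "eval_code P m d = {vec m (\<lambda>i. peval f (P i)) | f. f \<in> polys_le d}"

definition dual_code :: "nat \<Rightarrow> 'a::field vec set \<Rightarrow> 'a vec set" where
  "dual_code m C = {w \<in> carrier_vec m. \<forall>c\<in>C. w \<bullet> c = 0}"

definition scale_code :: "nat \<Rightarrow> (nat \<Rightarrow> 'a::field) \<Rightarrow> 'a vec set \<Rightarrow> 'a vec set" where
  "scale_code m \<beta> C = {vec m (\<lambda>i. \<beta> i * c $ i) | c. c \<in> C}"

section \<open>Homogenization\<close>

text \<open>The ring \<open>S[u]\<close> has variables indexed by \<^typ>\<open>'v option\<close>: \<^term>\<open>Some i\<close> is the old variable
  \<open>i\<close> and \<^term>\<open>None\<close> is \<open>u\<close>. In \<open>u^e f(t/u)\<close> a monomial \<open>t^a\<close> becomes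
  \<open>t^a u^(e - deg a)\<close>; the subtraction is not truncated for \<open>e = deg f\<close>.\<close>

definition homogenize_mon :: "nat \<Rightarrow> 'v::finite mon \<Rightarrow> 'v option mon" where
  "homogenize_mon e a =
     (\<Sum>i\<in>UNIV. Poly_Mapping.single (Some i) (Poly_Mapping.lookup a i)) +
     Poly_Mapping.single None (e - mon_deg a)"

definition homogenize :: "('v::finite, 'a::field) mpoly \<Rightarrow> ('v option, 'a) mpoly" where
  "homogenize f =
     (\<Sum>a\<in>Poly_Mapping.keys f.
        Poly_Mapping.single (homogenize_mon (total_deg f) a) (Poly_Mapping.lookup f a))"

definition homogenize_ideal ::
  "('v::finite, 'a::field) mpoly set \<Rightarrow> ('v option, 'a) mpoly set" where
  "homogenize_ideal I = ring_ideal.span (homogenize ` I)"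

section \<open>Graded Cohen--Macaulay and Gorenstein quotients\<close>

text \<open>Throughout, \<open>J\<close> stands for a proper homogeneous ideal of the standard graded polynomial ring
  \<open>A\<close>, and the notions concern \<open>A / J\<close>. The prime ideals of \<open>A / J\<close> are represented by the prime
  ideals of \<open>A\<close> containing \<open>J\<close>.\<close>

definition prime_ideal :: "'r::comm_ring_1 set \<Rightarrow> bool" where
  "prime_ideal Q \<longleftrightarrow> ring_ideal.subspace Q \<and> Q \<noteq> UNIV \<and> (\<forall>x y. x * y \<in> Q \<longrightarrow> x \<in> Q \<or> y \<in> Q)"

definition quot_krull_dim :: "'r::comm_ring_1 set \<Rightarrow> enat" where
  "quot_krull_dim J =
     Sup {enat n | n. \<exists>Q :: nat \<Rightarrow> 'r set.
       (\<forall>i\<le>n. prime_ideal (Q i) \<and> J \<subseteq> Q i) \<and> (\<forall>i<n. Q i \<subset> Q (Suc i))}"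

text \<open>The irrelevant maximal ideal, generated by the variables.\<close>

definition irrelevant_ideal :: "('v, 'a::field) mpoly set" where
  "irrelevant_ideal = {f. Poly_Mapping.lookup f 0 = 0}"

definition regular_sequence :: "'r::comm_ring_1 set \<Rightarrow> 'r list \<Rightarrow> bool" where
  "regular_sequence J xs \<longleftrightarrow>
     (\<forall>i<length xs. \<forall>y. xs ! i * y \<in> ring_ideal.span (J \<union> set (take i xs)) \<longrightarrow>
        y \<in> ring_ideal.span (J \<union> set (take i xs))) \<and>
     ring_ideal.span (J \<union> set xs) \<noteq> UNIV"

definition quot_depth :: "('v, 'a::field) mpoly set \<Rightarrow> enat" where
  "quot_depth J =
     Sup {enat (length xs) | xs. set xs \<subseteq> irrelevant_ideal \<and> regular_sequence J xs}"

definition cohen_macaulay_quot :: "('v, 'a::field) mpoly set \<Rightarrow> bool" where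
  "cohen_macaulay_quot J \<longleftrightarrow> quot_depth J = quot_krull_dim J"

text \<open>Homogeneous of degree \<open>d\<close>; the zero polynomial is so for every integer \<open>d\<close>.\<close>

definition homogeneous_of :: "int \<Rightarrow> ('v::finite, 'a::zero) mpoly \<Rightarrow> bool" where
  "homogeneous_of d f \<longleftrightarrow> (\<forall>a\<in>Poly_Mapping.keys f. int (mon_deg a) = d)"

text \<open>A finite graded free resolution
  \<open>0 \<longrightarrow> F p \<longrightarrow> \<dots> \<longrightarrow> F 1 \<longrightarrow> F 0 = A \<longrightarrow> A / J \<longrightarrow> 0\<close>
  is given by the matrices \<open>\<phi>s ! i\<close> of the maps \<open>F (i + 1) \<longrightarrow> F i\<close> (acting on column vectors)
  for \<open>i < p = length \<phi>s\<close>, and by the lists \<open>ds ! i\<close> of the degrees of the free generators of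
  \<open>F i\<close> for \<open>i \<le> p\<close>, so that \<open>F i\<close> is the direct sum of the modules \<open>A (- ds ! i ! j)\<close> and
  \<open>length (ds ! i)\<close> is its rank. \<open>res_kernel J \<phi>s i\<close> is the kernel of the map out of \<open>F i\<close>
  (to \<open>A / J\<close> for \<open>i = 0\<close>), \<open>res_image \<phi>s ds i\<close> the image of the map into \<open>F i\<close>.\<close>

definition res_kernel ::
  "'r::comm_ring_1 set \<Rightarrow> 'r mat list \<Rightarrow> nat \<Rightarrow> 'r vec set" where
  "res_kernel J \<phi>s i =
     (if i = 0 then {v \<in> carrier_vec 1. v $ 0 \<in> J} else mat_kernel (\<phi>s ! (i - 1)))"

definition res_image ::
  "'r::comm_ring_1 mat list \<Rightarrow> int list list \<Rightarrow> nat \<Rightarrow> 'r vec set" where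
  "res_image \<phi>s ds i =
     (if i < length \<phi>s
      then {(\<phi>s ! i) *\<^sub>v w | w. w \<in> carrier_vec (length (ds ! Suc i))}
      else {0\<^sub>v (length (ds ! i))})"

definition graded_free_resolution ::
  "('v::finite, 'a::field) mpoly set \<Rightarrow> ('v, 'a) mpoly mat list \<Rightarrow> int list list \<Rightarrow> bool" where
  "graded_free_resolution J \<phi>s ds \<longleftrightarrow>
     length ds = Suc (length \<phi>s) \<and> ds ! 0 = [0] \<and>
     (\<forall>i<length \<phi>s.
        \<phi>s ! i \<in> carrier_mat (length (ds ! i)) (length (ds ! Suc i)) \<and>
        (\<forall>j<length (ds ! i). \<forall>k<length (ds ! Suc i).
           homogeneous_of (ds ! Suc i ! k - ds ! i ! j) ((\<phi>s ! i) $$ (j, k)))) \<and>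
     (\<forall>i\<le>length \<phi>s. res_kernel J \<phi>s i = res_image \<phi>s ds i)"

definition minimal_graded_free_resolution ::
  "('v::finite, 'a::field) mpoly set \<Rightarrow> ('v, 'a) mpoly mat list \<Rightarrow> int list list \<Rightarrow> bool" where
  "minimal_graded_free_resolution J \<phi>s ds \<longleftrightarrow>
     graded_free_resolution J \<phi>s ds \<and>
     (\<forall>\<phi>\<in>set \<phi>s. elements_mat \<phi> \<subseteq> irrelevant_ideal)"

text \<open>The minimal graded free resolution is unique up to isomorphism, so its last Betti number
  can be read off from any one of them whose last module is nonzero.\<close>

definition gorenstein_quot :: "('v::finite, 'a::field) mpoly set \<Rightarrow> bool" where
  "gorenstein_quot J \<longleftrightarrow>
     cohen_macaulay_quot J \<and>
     (\<exists>\<phi>s ds. minimal_graded_free_resolution J \<phi>s ds \<and> length (last ds) = 1)"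

definition gorenstein_affine :: "('v::finite, 'a::field) mpoly set \<Rightarrow> bool" where
  "gorenstein_affine I \<longleftrightarrow> gorenstein_quot (homogenize_ideal I)"

end

theory Submission
  imports Defs
begin

text \<open>
  Put \<open>A = S[u]\<close>, \<open>J = I\<^sup>h\<close> and \<open>R = A / (J, u)\<close>. Dehomogenization identifies the part of degree \<open>d\<close>
  of \<open>R\<close> with \<open>S\<^bsub>\<le>d\<^esub> / (S\<^bsub>\<le>d-1\<^esub> + I\<^bsub>\<le>d\<^esub>)\<close>, and evaluation at the points identifies this with
  \<open>C\<^sub>X(d) / C\<^sub>X(d - 1)\<close>. So \<open>R\<close> is zero above degree \<open>r\<^sub>0\<close>, and all of its part of degree \<open>r\<^sub>0\<close> lies in
  the socle, that is, is killed by the variables. The theorem follows from the fact that the socle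
  of \<open>R\<close> is one-dimensional.

  \<^emph>\<open>The socle.\<close> Let \<open>F\<close> be a minimal free resolution of \<open>A / J\<close> whose last module has rank one, and
  reduce it modulo \<open>u\<close>, \<open>t\<^sub>1\<close>, \<dots>, \<open>t\<^sub>s\<close>, one variable after the other. As \<open>u\<close> is regular on \<open>A / J\<close>, the
  complex \<open>F / uF\<close> resolves \<open>R\<close>. Each \<open>t\<^sub>k\<close> is regular on \<open>A / (u, t\<^sub>1, \<dots>, t\<^sub>k\<^sub>-\<^sub>1)\<close>, so the long
  exact sequence of multiplication by \<open>t\<^sub>k\<close> shows that after reduction modulo \<open>u, t\<^sub>1, \<dots>, t\<^sub>k\<close> there is
  no homology above degree \<open>k\<close> (\<open>exact_mod\<close>), and that the homology in degree \<open>k\<close> is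
  the annihilator of \<open>t\<^sub>1, \<dots>, t\<^sub>k\<close> in \<open>R\<close> (\<open>linked_trivial_iff\<close>, \<open>linked_exists\<close>). After the last
  variable all maps are zero by minimality. Hence \<open>F\<^sub>i = 0\<close> for \<open>i > s\<close>, and the socle of \<open>R\<close> embeds into
  \<open>F\<^sub>s\<close> modulo the variables, whose dimension is at most one because the last nonzero module, of
  rank one, is \<open>F\<^sub>s\<close> or an earlier one (\<open>gorenstein_socle_relation\<close>, \<open>affine_socle_relation\<close>).

  \<^emph>\<open>The duality.\<close> The part of degree \<open>r\<^sub>0\<close> of \<open>R\<close> is nonzero, so it is all of the socle. Hence
  \<open>C\<^sub>X(r\<^sub>0 - 1)\<close> is a hyperplane \<open>\<Sum>\<^sub>i \<mu>\<^sub>i w\<^sub>i = 0\<close> in \<open>K\<^sup>m = C\<^sub>X(r\<^sub>0)\<close>, and there is no socle below degree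
  \<open>r\<^sub>0\<close>. Suppose that \<open>f\<close> of degree at most
  \<open>d\<close> satisfies \<open>\<Sum>\<^sub>i \<mu>\<^sub>i f(P\<^sub>i) g(P\<^sub>i) = 0\<close> for all \<open>g\<close> of degree at most \<open>r\<^sub>0 - d\<close>. Then each \<open>t\<^sub>j f\<close> satisfies
  the same condition in degree \<open>d + 1\<close>, so by descending induction on \<open>d\<close> the class of \<open>f\<close> in
  degree \<open>d\<close> of \<open>R\<close> is in the socle, hence zero: the values of \<open>f\<close> are in \<open>C\<^sub>X(d - 1)\<close>
  (\<open>pairing_nondegenerate\<close>). Applied to the indicator of a point, of least possible degree, this
  gives \<open>\<mu>\<^sub>i \<noteq> 0\<close>. Applied to \<open>w / \<mu>\<close> for \<open>w \<in> C\<^sub>X(d)\<^sup>\<bottom>\<close>, again represented in least degree, it shows that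
  \<open>w / \<mu>\<close> lies in \<open>C\<^sub>X(r\<^sub>0 - d - 1)\<close> (\<open>code_duality\<close>).

  \<^emph>\<open>The leading coefficients.\<close> Exactly one standard monomial has degree \<open>r\<^sub>0\<close>, and it is the leading
  monomial of every \<open>f\<^sub>i\<close> because \<open>\<mu>\<^sub>i \<noteq> 0\<close> keeps \<open>f\<^sub>i\<close> out of degree \<open>r\<^sub>0 - 1\<close>. Therefore
  \<open>lc(f\<^sub>i) f\<^sub>j - lc(f\<^sub>j) f\<^sub>i\<close> has degree less than \<open>r\<^sub>0\<close>, which says \<open>lc(f\<^sub>i) \<mu>\<^sub>j = lc(f\<^sub>j) \<mu>\<^sub>i\<close>: up to a nonzero
  scalar, \<open>\<mu>\<^sub>i\<close> is \<open>lc(f\<^sub>i)\<close> (\<open>lead_coef_proportional\<close>).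
\<close>

section \<open>Resolutions modulo a regular sequence\<close>

text \<open>As a rewrite rule this is \<open>a * (b * x) = a * b * x\<close>, which loops together with associativity
  read from left to right.\<close>

declare ring_ideal.scale_scale [simp del]

text \<open>The complex \<open>F\<close> has modules \<open>F\<^sub>i\<close> of rank \<open>b i\<close> and maps \<open>D i : F\<^sub>i\<^sub>+\<^sub>1 \<longrightarrow> F\<^sub>i\<close> with matrices \<open>M i\<close>; it
  resolves the quotient of \<open>F\<^sub>0\<close> by \<open>J\<close>. An element of \<open>F\<^sub>i\<close> is any function on \<^typ>\<open>nat\<close>, of which only the
  values below \<open>b i\<close> count; this makes the zero modules beyond the length of a resolution harmless.
  The ideal \<open>Q n\<close> is generated by the first \<open>n\<close> members of the sequence \<open>x\<close>, which has \<open>s + 1\<close> members,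
  is regular on the ring, and starts with an element that is also regular modulo \<open>J\<close>.\<close>

locale resolution_along_sequence =
  fixes b :: "nat \<Rightarrow> nat"
    and M :: "nat \<Rightarrow> nat \<Rightarrow> nat \<Rightarrow> 'r::comm_ring_1"
    and J :: "'r set" and Q :: "nat \<Rightarrow> 'r set" and x :: "nat \<Rightarrow> 'r" and s :: nat
    and D :: "nat \<Rightarrow> (nat \<Rightarrow> 'r) \<Rightarrow> nat \<Rightarrow> 'r"
  assumes D_def: "D i w l = (\<Sum>k<b (Suc i). M i l k * w k)"
    and rank_0: "b 0 = 1"
    and range_0: "D 0 w 0 \<in> J"
    and onto_J: "e \<in> J \<Longrightarrow> \<exists>w. D 0 w 0 = e"
    and complex: "l < b i \<Longrightarrow> D i (D (Suc i) w) l = 0"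
    and exact: "(\<And>l. l < b i \<Longrightarrow> D i v l = 0) \<Longrightarrow> \<exists>w. \<forall>l<b (Suc i). v l = D (Suc i) w l"
    and ideal_Q: "ring_ideal.subspace (Q n)"
    and Q_0: "Q 0 = {0}"
    and Q_Suc: "n \<le> s \<Longrightarrow> Q (Suc n) = {q + x n * y | q y. q \<in> Q n}"
    and regular: "n \<le> s \<Longrightarrow> x n * y \<in> Q n \<Longrightarrow> y \<in> Q n"
    and regular_J: "x 0 * y \<in> J \<Longrightarrow> y \<in> J"
    and minimal: "l < b i \<Longrightarrow> k < b (Suc i) \<Longrightarrow> M i l k \<in> Q (Suc s)"
begin

lemma D_add: "D i (\<lambda>k. v k + w k) l = D i v l + D i w l"
  by (simp add: D_def distrib_left sum.distrib)

lemma D_diff: "D i (\<lambda>k. v k - w k) l = D i v l - D i w l"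
  by (simp add: D_def right_diff_distrib sum_subtractf)

lemma D_smult: "D i (\<lambda>k. c * v k) l = c * D i v l"
  by (simp add: D_def sum_distrib_left ac_simps)

lemma D_in_Q: "(\<And>k. k < b (Suc i) \<Longrightarrow> v k \<in> Q n) \<Longrightarrow> D i v l \<in> Q n"
  unfolding D_def using ideal_Q[of n] by (intro ring_ideal.subspace_sum ring_ideal.subspace_scale) auto

lemmas Q_add = ring_ideal.subspace_add[OF ideal_Q]
lemmas Q_diff = ring_ideal.subspace_diff[OF ideal_Q]
lemmas Q_mult = ring_ideal.subspace_scale[OF ideal_Q]

lemma Q_SucI: "n \<le> s \<Longrightarrow> f - x n * y \<in> Q n \<Longrightarrow> f \<in> Q (Suc n)"
  unfolding Q_Suc mem_Collect_eq by (intro exI[of _ "f - x n * y"] exI[of _ y]) simp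

lemma Q_SucE:
  assumes "n \<le> s" "\<And>l. l < N \<Longrightarrow> f l \<in> Q (Suc n)"
  shows "\<exists>y. \<forall>l<N. f l - x n * y l \<in> Q n"
proof -
  have "\<forall>l\<in>{..<N}. \<exists>y. f l - x n * y \<in> Q n"
  proof
    fix l assume "l \<in> {..<N}"
    then have "f l \<in> Q (Suc n)" by (intro assms(2)) simp
    then obtain q y where "f l = q + x n * y" "q \<in> Q n" by (auto simp: Q_Suc[OF assms(1)])
    then have "f l - x n * y \<in> Q n" by simp
    then show "\<exists>y. f l - x n * y \<in> Q n" ..
  qed
  from bchoice[OF this] show ?thesis by auto
qed

text \<open>In degrees at least \<open>n\<close> (and at least 1) the complex stays exact modulo \<open>Q n\<close>. For the step from
  \<open>n\<close> to \<open>n + 1\<close>, a cycle modulo \<open>Q (n + 1)\<close> satisfies \<open>D v = x\<^sub>n y\<close> modulo \<open>Q n\<close>; regularity of \<open>x\<^sub>n\<close> makes \<open>y\<close> a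
  cycle modulo \<open>Q n\<close>, hence a boundary \<open>D w\<close>, and then \<open>v - x\<^sub>n w\<close> is a cycle modulo \<open>Q n\<close>. In the lowest
  degree, \<open>y \<in> F\<^sub>0\<close> is a boundary because \<open>x\<^sub>0\<close> is regular modulo \<open>J\<close>.\<close>

lemma exact_mod:
  "n \<le> Suc s \<Longrightarrow> n \<le> Suc j \<Longrightarrow> (\<And>l. l < b j \<Longrightarrow> D j v l \<in> Q n) \<Longrightarrow>
    \<exists>w. \<forall>l<b (Suc j). v l - D (Suc j) w l \<in> Q n"
proof (induction n arbitrary: j v)
  case 0
  then show ?case using exact[of j v] by (auto simp: Q_0)
next
  case (Suc n)
  note IH = Suc.IH
  have n: "n \<le> s" and nj: "n \<le> j" using Suc.prems by auto
  from Q_SucE[of n "b j" "D j v", OF n Suc.prems(3)]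
  obtain y where y: "\<And>l. l < b j \<Longrightarrow> D j v l - x n * y l \<in> Q n" by blast
  \<comment> \<open>Up to a boundary, \<open>y\<close> is zero modulo \<open>Q n\<close>.\<close>
  have "\<exists>w. \<forall>l<b j. y l - D j w l \<in> Q n"
  proof (cases j)
    case 0
    with nj have n0: "n = 0" by simp
    with y[of 0] 0 have "D 0 v 0 = x 0 * y 0" by (simp add: Q_0 rank_0)
    with range_0[of v] have "y 0 \<in> J" using regular_J[of "y 0"] by metis
    then obtain w where "D 0 w 0 = y 0" using onto_J by blast
    then show ?thesis using 0 n0 by (intro exI[of _ w]) (simp add: rank_0 Q_0)
  next
    case (Suc i)
    have "D i y l \<in> Q n" if l: "l < b i" for l
    proof -
      have "D i (\<lambda>l. D j v l - x n * y l) l \<in> Q n" using y Suc by (intro D_in_Q) simp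
      then have "D i (D j v) l - x n * D i y l \<in> Q n"
        using D_diff[of i "D j v" "\<lambda>l. x n * y l"] by (simp add: D_smult)
      then have "0 - x n * D i y l \<in> Q n" using complex[OF l, of v] Suc by simp
      then have "x n * D i y l \<in> Q n" using Q_diff[of 0 n "0 - x n * D i y l"] ring_ideal.subspace_0[OF ideal_Q] by simp
      then show ?thesis using regular n by blast
    qed
    then show ?thesis using IH[of i y] n nj Suc by simp
  qed
  then obtain w where w: "\<And>l. l < b j \<Longrightarrow> y l - D j w l \<in> Q n" by blast
  have "D j (\<lambda>l. v l - x n * w l) l \<in> Q n" if "l < b j" for l
  proof -
    have "(D j v l - x n * y l) + x n * (y l - D j w l) \<in> Q n"
      by (rule Q_add[OF y[OF that] Q_mult[OF w[OF that]]])
    then show ?thesis unfolding D_diff D_smult by (simp add: right_diff_distrib)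
  qed
  then obtain w' where "\<And>l. l < b (Suc j) \<Longrightarrow> v l - x n * w l - D (Suc j) w' l \<in> Q n"
    using IH[of j "\<lambda>l. v l - x n * w l"] n nj by auto
  then have "\<And>l. l < b (Suc j) \<Longrightarrow> (v l - D (Suc j) w' l) - x n * w l \<in> Q n"
    by (simp add: algebra_simps)
  from Q_SucI[OF n this]
  have "\<And>l. l < b (Suc j) \<Longrightarrow> v l - D (Suc j) w' l \<in> Q (Suc n)" .
  then show ?case by blast
qed

text \<open>Modulo \<open>Q (j + 1)\<close> the complex has homology in degree \<open>j\<close> isomorphic to the elements of the quotient
  by \<open>(J, x\<^sub>0)\<close> that \<open>x\<^sub>1, \<dots>, x\<^sub>j\<close> annihilate. The relation \<open>linked j z v\<close> says that the class of the cycle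
  \<open>v \<in> F\<^sub>j\<close> goes to the class of \<open>z\<close>: by definition the connecting homomorphism divides the boundary
  \<open>D v\<close> by \<open>x\<^sub>j\<close>. A relation is used in place of a map because \<open>v\<close> is determined only up to boundaries.\<close>

fun linked :: "nat \<Rightarrow> 'r \<Rightarrow> (nat \<Rightarrow> 'r) \<Rightarrow> bool" where
  "linked 0 z v \<longleftrightarrow> v 0 = z"
| "linked (Suc j) z v \<longleftrightarrow>
     (\<exists>v'. linked j z v' \<and> (\<forall>l<b j. x (Suc j) * v' l - D j v l \<in> Q (Suc j)))"

lemma linked_comb:
  "linked j z v \<Longrightarrow> linked j z' v' \<Longrightarrow> linked j (c * z + c' * z') (\<lambda>l. c * v l + c' * v' l)"
proof (induction j arbitrary: v v')
  case (Suc j)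
  from Suc.prems(1) obtain w where
    w: "linked j z w" "\<And>l. l < b j \<Longrightarrow> x (Suc j) * w l - D j v l \<in> Q (Suc j)"
    unfolding linked.simps by blast
  from Suc.prems(2) obtain w' where
    w': "linked j z' w'" "\<And>l. l < b j \<Longrightarrow> x (Suc j) * w' l - D j v' l \<in> Q (Suc j)"
    unfolding linked.simps by blast
  have "x (Suc j) * (c * w l + c' * w' l) - D j (\<lambda>l. c * v l + c' * v' l) l \<in> Q (Suc j)"
    if "l < b j" for l
  proof -
    have "c * (x (Suc j) * w l - D j v l) + c' * (x (Suc j) * w' l - D j v' l) \<in> Q (Suc j)"
      by (rule Q_add[OF Q_mult[OF w(2)[OF that]] Q_mult[OF w'(2)[OF that]]])
    moreover have "c * (x (Suc j) * w l - D j v l) + c' * (x (Suc j) * w' l - D j v' l)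
        = x (Suc j) * (c * w l + c' * w' l) - (c * D j v l + c' * D j v' l)"
      by (simp add: algebra_simps)
    ultimately show ?thesis unfolding D_add D_smult by simp
  qed
  with Suc.IH[OF w(1) w'(1)] show ?case unfolding linked.simps by blast
qed simp

definition J_plus :: "'r set" where
  "J_plus = {z. \<exists>y. z - x 0 * y \<in> J}"

definition bounds_mod :: "nat \<Rightarrow> (nat \<Rightarrow> 'r) \<Rightarrow> bool" where
  "bounds_mod j v \<longleftrightarrow> (\<exists>w. \<forall>l<b j. v l - D j w l \<in> Q (Suc j))"

text \<open>The isomorphism is well defined and injective. Both directions of the step compare \<open>x\<^sub>j v' = D v\<close>
  with a representation of one of the two classes as a boundary; from left to right \<open>exact_mod\<close>
  gives the missing preimage, from right to left the factor \<open>x\<^sub>j\<close> is cancelled.\<close>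

lemma linked_trivial_iff:
  "j \<le> s \<Longrightarrow> linked j z v \<Longrightarrow> z \<in> J_plus \<longleftrightarrow> bounds_mod j v"
proof (induction j arbitrary: v)
  case 0
  have Q1: "f \<in> Q (Suc 0) \<longleftrightarrow> (\<exists>y. f = x 0 * y)" for f
    using Q_Suc[of 0] by (auto simp: Q_0)
  show ?case
  proof
    assume "z \<in> J_plus"
    then obtain y where "z - x 0 * y \<in> J" by (auto simp: J_plus_def)
    with onto_J obtain w where w: "D 0 w 0 = z - x 0 * y" by blast
    have "z - D 0 w 0 = x 0 * y" unfolding w by simp
    then show "bounds_mod 0 v" using 0 unfolding bounds_mod_def by (auto simp: rank_0 Q1)
  next
    assume "bounds_mod 0 v"
    then obtain w y where wy: "z - D 0 w 0 = x 0 * y"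
      using 0 unfolding bounds_mod_def by (auto simp: rank_0 Q1)
    have "z - x 0 * y = D 0 w 0" unfolding wy[symmetric] by simp
    then have "z - x 0 * y \<in> J" using range_0[of w] by simp
    then show "z \<in> J_plus" unfolding J_plus_def by blast
  qed
next
  case (Suc j)
  from Suc.prems(2) obtain v' where v': "linked j z v'"
    and eq: "\<And>l. l < b j \<Longrightarrow> x (Suc j) * v' l - D j v l \<in> Q (Suc j)"
    unfolding linked.simps by blast
  have "z \<in> J_plus \<longleftrightarrow> bounds_mod j v'" using Suc v' by simp
  also have "\<dots> \<longleftrightarrow> bounds_mod (Suc j) v"
  proof
    assume "bounds_mod j v'"
    then obtain w where w: "\<And>l. l < b j \<Longrightarrow> v' l - D j w l \<in> Q (Suc j)"
      unfolding bounds_mod_def by blast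
    have "D j (\<lambda>k. v k - x (Suc j) * w k) l \<in> Q (Suc j)" if "l < b j" for l
    proof -
      have "x (Suc j) * (v' l - D j w l) - (x (Suc j) * v' l - D j v l) \<in> Q (Suc j)"
        by (rule Q_diff[OF Q_mult[OF w[OF that]] eq[OF that]])
      then show ?thesis unfolding D_diff D_smult by (simp add: right_diff_distrib)
    qed
    then obtain w' where
      "\<And>l. l < b (Suc j) \<Longrightarrow> v l - x (Suc j) * w l - D (Suc j) w' l \<in> Q (Suc j)"
      using exact_mod[of "Suc j" j "\<lambda>k. v k - x (Suc j) * w k"] Suc.prems by auto
    then have "\<And>l. l < b (Suc j) \<Longrightarrow> (v l - D (Suc j) w' l) - x (Suc j) * w l \<in> Q (Suc j)"
      by (simp add: algebra_simps)
    from Q_SucI[OF Suc.prems(1) this]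
    have "\<And>l. l < b (Suc j) \<Longrightarrow> v l - D (Suc j) w' l \<in> Q (Suc (Suc j))" .
    then show "bounds_mod (Suc j) v" unfolding bounds_mod_def by blast
  next
    assume "bounds_mod (Suc j) v"
    then obtain w where "\<And>l. l < b (Suc j) \<Longrightarrow> v l - D (Suc j) w l \<in> Q (Suc (Suc j))"
      unfolding bounds_mod_def by blast
    from Q_SucE[of "Suc j" "b (Suc j)" "\<lambda>l. v l - D (Suc j) w l", OF Suc.prems(1) this] obtain y where
      y: "\<And>l. l < b (Suc j) \<Longrightarrow> v l - D (Suc j) w l - x (Suc j) * y l \<in> Q (Suc j)" by blast
    have "v' l - D j y l \<in> Q (Suc j)" if l: "l < b j" for l
    proof -
      have "D j (\<lambda>l. (v l - D (Suc j) w l) - x (Suc j) * y l) l \<in> Q (Suc j)"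
        using y by (intro D_in_Q) auto
      then have "D j v l - x (Suc j) * D j y l \<in> Q (Suc j)"
        using complex[OF l, of w] by (simp add: D_diff D_smult)
      then have "(x (Suc j) * v' l - D j v l) + (D j v l - x (Suc j) * D j y l) \<in> Q (Suc j)"
        using eq[OF l] Q_add by blast
      then have "x (Suc j) * (v' l - D j y l) \<in> Q (Suc j)" by (simp add: algebra_simps)
      then show ?thesis using regular[OF Suc.prems(1)] by blast
    qed
    then show "bounds_mod j v'" unfolding bounds_mod_def by blast
  qed
  finally show ?case .
qed

text \<open>An annihilated \<open>z\<close> lifts step by step: if \<open>v \<in> F\<^sub>j\<close> belongs to \<open>z\<close>, then with \<open>x = x\<^sub>j\<^sub>+\<^sub>1\<close> the cycle
  \<open>x v\<close> belongs to \<open>x z\<close>, whose class is zero, so \<open>x v\<close> is the boundary of an element of \<open>F\<^sub>j\<^sub>+\<^sub>1\<close>.\<close>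

lemma linked_exists:
  assumes "j \<le> s" and "\<And>i. 0 < i \<Longrightarrow> i \<le> s \<Longrightarrow> x i * z \<in> J_plus"
  shows "\<exists>v. linked j z v"
  using assms(1)
proof (induction j)
  case 0
  show ?case by (auto intro: exI[of _ "\<lambda>_. z"])
next
  case (Suc j)
  then obtain v where v: "linked j z v" by auto
  have "linked j (x (Suc j) * z) (\<lambda>l. x (Suc j) * v l)"
    using linked_comb[OF v v, of "x (Suc j)" 0] by simp
  then have "bounds_mod j (\<lambda>l. x (Suc j) * v l)"
    using linked_trivial_iff[of j] assms(2)[of "Suc j"] Suc.prems by simp
  with v show ?case by (auto simp: bounds_mod_def)
qed

lemma minimal_D: "l < b i \<Longrightarrow> D i w l \<in> Q (Suc s)"
  unfolding D_def using minimal[of l i] Q_mult[of "M i l _" "Suc s"]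
  by (intro ring_ideal.subspace_sum[OF ideal_Q]) (auto simp: mult.commute)

text \<open>Minimality makes every vector a cycle modulo the whole sequence. In degrees above \<open>s\<close> the complex
  is exact modulo the sequence, so if nothing maps into \<open>F\<^sub>p\<close>, then a vector of ones lies in
  \<open>Q (s + 1) F\<^sub>p\<close>, which is absurd unless \<open>F\<^sub>p = 0\<close>.\<close>

lemma rank_zero_beyond:
  assumes "1 \<notin> Q (Suc s)" and "s < p" and "b (Suc p) = 0"
  shows "b p = 0"
proof (rule ccontr)
  assume "b p \<noteq> 0"
  from \<open>s < p\<close> obtain j where p: "p = Suc j" by (cases p) auto
  have "D j (\<lambda>_. 1) l \<in> Q (Suc s)" if "l < b j" for l using minimal_D that .
  then obtain w where "\<forall>l<b p. 1 - D p w l \<in> Q (Suc s)"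
    using exact_mod[of "Suc s" j "\<lambda>_. 1"] assms p by auto
  moreover have "D p w l = 0" for l using assms(3) by (simp add: D_def)
  ultimately show False using assms(1) \<open>b p \<noteq> 0\<close> by auto
qed

text \<open>For rank at most one the cycles \<open>v\<close>, \<open>v'\<close> belonging to \<open>z\<close>, \<open>z'\<close> are single ring elements. The
  constants \<open>C\<close> represent all residues modulo \<open>Q (s + 1)\<close>: if \<open>a\<close>, \<open>a'\<close> are the residues of \<open>v\<close>, \<open>v'\<close>, then
  \<open>a' v - a v'\<close> has residue zero, so \<open>a' z - a z'\<close> is trivial.\<close>

lemma socle_relation:
  assumes top: "b s \<le> 1"
    and C: "\<And>g. \<exists>c\<in>C. g - c \<in> Q (Suc s)" "0 \<in> C" "1 \<in> C" "\<And>c. c \<in> C \<Longrightarrow> - c \<in> C"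
    and z: "\<And>i. 0 < i \<Longrightarrow> i \<le> s \<Longrightarrow> x i * z \<in> J_plus"
    and z': "\<And>i. 0 < i \<Longrightarrow> i \<le> s \<Longrightarrow> x i * z' \<in> J_plus"
    and "(0::'r) \<noteq> 1"
  shows "\<exists>c\<in>C. \<exists>c'\<in>C. (c \<noteq> 0 \<or> c' \<noteq> 0) \<and> c * z + c' * z' \<in> J_plus"
proof -
  from linked_exists[OF order_refl z] obtain v where v: "linked s z v" ..
  from linked_exists[OF order_refl z'] obtain v' where v': "linked s z' v'" ..
  have *: "c * z + c' * z' \<in> J_plus" if "c * v 0 + c' * v' 0 \<in> Q (Suc s)" for c c'
  proof -
    have "c * v l + c' * v' l - D s (\<lambda>_. 0) l \<in> Q (Suc s)" if "l < b s" for l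
    proof -
      have "l = 0" using that top by simp
      then show ?thesis using \<open>c * v 0 + c' * v' 0 \<in> Q (Suc s)\<close> by (simp add: D_def)
    qed
    then have "bounds_mod s (\<lambda>l. c * v l + c' * v' l)" unfolding bounds_mod_def by blast
    then show ?thesis using linked_trivial_iff[OF order_refl linked_comb[OF v v']] by blast
  qed
  obtain a where a: "a \<in> C" "v 0 - a \<in> Q (Suc s)" using C(1) by blast
  obtain a' where a': "a' \<in> C" "v' 0 - a' \<in> Q (Suc s)" using C(1) by blast
  show ?thesis
  proof (cases "a = 0 \<and> a' = 0")
    case True
    then have "1 * v 0 + 0 * v' 0 \<in> Q (Suc s)" using a by auto
    from *[OF this] show ?thesis using C(2,3) \<open>0 \<noteq> 1\<close> by (intro bexI[of _ 1] bexI[of _ 0]) auto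
  next
    case False
    have "a' * (v 0 - a) + (- a) * (v' 0 - a') \<in> Q (Suc s)"
      by (rule Q_add[OF Q_mult[OF a(2)] Q_mult[OF a'(2)]])
    then have "a' * v 0 + (- a) * v' 0 \<in> Q (Suc s)" by (simp add: algebra_simps)
    from *[OF this] show ?thesis using False a(1) a'(1) C(4)
      by (intro bexI[of _ a'] bexI[of _ "-a"]) auto
  qed
qed

end

section \<open>Ideals of variables and the socle modulo one variable\<close>

abbreviation lookup where "lookup \<equiv> Poly_Mapping.lookup"
abbreviation keys where "keys \<equiv> Poly_Mapping.keys"

lemma mpoly_eq_sum: "f = (\<Sum>a\<in>keys f. Poly_Mapping.single a (lookup f a))"
  by (rule poly_mapping_eqI) (simp add: lookup_sum lookup_single when_def in_keys_iff)

lemma mpoly_induct [case_names single add]: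
  fixes f :: "'k \<Rightarrow>\<^sub>0 'b::comm_monoid_add"
  assumes "\<And>a c. P (Poly_Mapping.single a c)" and "\<And>f g. P f \<Longrightarrow> P g \<Longrightarrow> P (f + g)"
  shows "P f"
proof -
  have "P (\<Sum>a\<in>A. Poly_Mapping.single a (lookup f a))" if "finite A" for A
    using that
  proof induction
    case empty
    show ?case using assms(1)[of undefined 0] by simp
  qed (simp add: assms)
  from this[OF finite_keys[of f]] show ?thesis using mpoly_eq_sum[of f] by simp
qed

lemma lookup_single_mult:
  fixes f :: "('v, 'a::comm_ring_1) mpoly"
  shows "lookup (Poly_Mapping.single b c * f) (b + a) = c * lookup f a"
  by (induction f rule: mpoly_induct)
     (simp_all add: mult_single lookup_single when_def distrib_left lookup_add)

definition var :: "'w \<Rightarrow> ('w, 'a::comm_ring_1) mpoly" where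
  "var i = Poly_Mapping.single (Poly_Mapping.single i 1) 1"

definition vars_ideal :: "'w set \<Rightarrow> ('w, 'a::comm_ring_1) mpoly set" where
  "vars_ideal V = {f. \<forall>a\<in>keys f. \<exists>i\<in>V. lookup a i \<noteq> 0}"

lemma subspace_vars_ideal: "ring_ideal.subspace (vars_ideal V)"
proof (rule ring_ideal.subspaceI)
  show "0 \<in> vars_ideal V" by (simp add: vars_ideal_def)
next
  fix f g :: "('a, 'b) mpoly" assume "f \<in> vars_ideal V" "g \<in> vars_ideal V"
  then show "f + g \<in> vars_ideal V" using keys_add[of f g] by (auto simp: vars_ideal_def)
next
  fix c f :: "('a, 'b) mpoly" assume f: "f \<in> vars_ideal V"
  show "c * f \<in> vars_ideal V"
    unfolding vars_ideal_def
  proof (intro CollectI ballI)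
    fix a assume "a \<in> keys (c * f)"
    then obtain a1 a2 where a: "a = a1 + a2" "a2 \<in> keys f" using keys_mult[of c f] by blast
    then obtain i where "i \<in> V" "lookup a2 i \<noteq> 0" using f by (auto simp: vars_ideal_def)
    then show "\<exists>i\<in>V. lookup a i \<noteq> 0" using a by (auto simp: lookup_add intro!: bexI[of _ i])
  qed
qed

lemma vars_ideal_empty: "vars_ideal {} = {0}"
  by (auto simp: vars_ideal_def)

text \<open>Membership in an ideal generated by variables is decided monomial by monomial. A monomial that
  meets \<open>insert i V\<close> but not \<open>V\<close> is divisible by the variable \<open>i\<close>.\<close>

lemma vars_ideal_insert:
  "vars_ideal (insert i V) = {q + var i * y | q y. q \<in> vars_ideal V}" (is "_ = ?R")
proof
  have "f \<in> vars_ideal (insert i V) \<longrightarrow> f \<in> ?R" for f :: "('a, 'b) mpoly"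
  proof -
    have R0: "0 \<in> ?R" using ring_ideal.subspace_0[OF subspace_vars_ideal]
      by (auto intro!: exI[of _ 0])
    have R_add: "f + g \<in> ?R" if fg: "f \<in> ?R" "g \<in> ?R" for f g
    proof -
      obtain q y q' y' where "f = q + var i * y" "q \<in> vars_ideal V"
        "g = q' + var i * y'" "q' \<in> vars_ideal V" using fg by blast
      then have "f + g = (q + q') + var i * (y + y')" "q + q' \<in> vars_ideal V"
        by (auto simp: algebra_simps ring_ideal.subspace_add[OF subspace_vars_ideal])
      then show ?thesis by blast
    qed
    have R_single: "Poly_Mapping.single a c \<in> ?R" if "\<exists>j\<in>insert i V. lookup a j \<noteq> 0" for a c
    proof (cases "\<exists>j\<in>V. lookup a j \<noteq> 0")
      case True
      then have "Poly_Mapping.single a c \<in> vars_ideal V" by (simp add: vars_ideal_def)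
      then show ?thesis by (intro CollectI exI[of _ "Poly_Mapping.single a c"] exI[of _ 0]) simp
    next
      case False
      with that have "lookup a i \<noteq> 0" by auto
      then have "a = Poly_Mapping.single i 1 + (a - Poly_Mapping.single i 1)"
        by (intro poly_mapping_eqI) (auto simp: lookup_add lookup_minus lookup_single when_def)
      then have "Poly_Mapping.single a c = 0 + var i * Poly_Mapping.single (a - Poly_Mapping.single i 1) c"
        by (simp add: var_def mult_single)
      then show ?thesis using ring_ideal.subspace_0[OF subspace_vars_ideal] by blast
    qed
    have "(\<Sum>a\<in>A. Poly_Mapping.single a (lookup f a)) \<in> ?R"
      if "finite A" "\<forall>a\<in>A. \<exists>j\<in>insert i V. lookup a j \<noteq> 0" for A
      using that
    proof induction
      case empty
      show ?case using R0 by simp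
    next
      case (insert a A)
      then show ?case
        by (simp only: sum.insert not_False_eq_True) (intro R_add R_single, auto)
    qed
    from this[of "keys f"] show ?thesis using mpoly_eq_sum[of f] by (auto simp: vars_ideal_def)
  qed
  then show "vars_ideal (insert i V) \<subseteq> ?R" by blast
  show "?R \<subseteq> vars_ideal (insert i V)"
  proof
    fix f assume "f \<in> ?R"
    then obtain q y where f: "f = q + var i * y" and q: "q \<in> vars_ideal V" by blast
    have "q \<in> vars_ideal (insert i V)" using q by (auto simp: vars_ideal_def)
    moreover have "var i \<in> vars_ideal (insert i V)" by (simp add: vars_ideal_def var_def)
    then have "var i * y \<in> vars_ideal (insert i V)"
      using ring_ideal.subspace_scale[OF subspace_vars_ideal, of "var i" "insert i V" y]
      by (simp add: mult.commute)
    ultimately show "f \<in> vars_ideal (insert i V)"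
      unfolding f by (rule ring_ideal.subspace_add[OF subspace_vars_ideal])
  qed
qed

lemma var_regular_mod_vars_ideal:
  assumes "var i * f \<in> vars_ideal V" "i \<notin> V"
  shows "f \<in> vars_ideal V"
  unfolding vars_ideal_def
proof (intro CollectI ballI)
  fix a assume "a \<in> keys f"
  then have "Poly_Mapping.single i 1 + a \<in> keys (var i * f)"
    unfolding var_def in_keys_iff by (simp only: lookup_single_mult) simp
  then obtain j where j: "j \<in> V" "lookup (Poly_Mapping.single i 1 + a) j \<noteq> 0"
    using assms(1) unfolding vars_ideal_def by blast
  moreover from j assms(2) have "j \<noteq> i" by auto
  ultimately show "\<exists>j\<in>V. lookup a j \<noteq> 0"
    by (auto simp: lookup_add lookup_single intro!: bexI[of _ j])
qed

lemma irrelevant_ideal_eq_vars_ideal: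
  "irrelevant_ideal = (vars_ideal UNIV :: ('b, 'a::field) mpoly set)"
proof -
  have "lookup f 0 = 0 \<longleftrightarrow> (\<forall>a\<in>keys f. \<exists>i. lookup a i \<noteq> 0)" for f :: "('b, 'a) mpoly"
  proof -
    have "(\<exists>i. lookup a i \<noteq> 0) \<longleftrightarrow> a \<noteq> 0" for a :: "'b mon"
      by (metis lookup_zero poly_mapping_eqI)
    then show ?thesis by (auto simp: in_keys_iff)
  qed
  then show ?thesis by (auto simp: irrelevant_ideal_def vars_ideal_def)
qed

text \<open>Homogenization singles out one variable, which has to come first in the regular sequence.\<close>

lemma enumerate_from:
  obtains e :: "nat \<Rightarrow> 'w::finite" where "e 0 = u" "inj_on e {..<card (UNIV :: 'w set)}" "e ` {..<card (UNIV :: 'w set)} = UNIV"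
proof -
  have "finite (UNIV - {u})" by simp
  then obtain g where g: "bij_betw g {0..<card (UNIV - {u})} (UNIV - {u})"
    using ex_bij_betw_nat_finite by blast
  define e where "e i = (case i of 0 \<Rightarrow> u | Suc j \<Rightarrow> g j)" for i
  have card: "card (UNIV :: 'w set) = Suc (card (UNIV - {u}))"
    using card.remove[of UNIV u] by simp
  have lt: "{..<card (UNIV :: 'w set)} = insert 0 (Suc ` {0..<card (UNIV - {u})})"
    unfolding card using lessThan_Suc_eq_insert_0 by (simp add: atLeast0LessThan)
  have img: "e ` Suc ` {0..<card (UNIV - {u})} = UNIV - {u}"
    using g by (simp add: e_def image_image bij_betw_def del: image_Suc_atLeastLessThan)
  have "e ` {..<card (UNIV :: 'w set)} = UNIV" unfolding lt image_insert img by (auto simp: e_def)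
  moreover have "inj_on e {..<card (UNIV :: 'w set)}"
    using calculation by (intro eq_card_imp_inj_on) auto
  moreover have "e 0 = u" by (simp add: e_def)
  ultimately show thesis using that by blast
qed

text \<open>Any two elements whose products with the variables other than \<open>u\<close> lie in \<open>(J, u)\<close> are linearly
  dependent modulo \<open>(J, u)\<close>. The matrices of the resolution satisfy the assumptions of the locale for
  the sequence of all variables starting with \<open>u\<close>, and the rank \<open>b s\<close> is at most one: it is zero beyond the
  length \<open>p\<close> of the resolution, it is one for \<open>s = p\<close>, and \<open>s < p\<close> would force the last module to be zero.\<close>

lemma gorenstein_socle_relation:
  fixes J :: "('w::finite, 'a::field) mpoly set" and u :: 'w
  assumes gor: "gorenstein_quot J"
    and reg: "\<And>f. var u * f \<in> J \<Longrightarrow> f \<in> J"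
    and z: "\<And>i. i \<noteq> u \<Longrightarrow> \<exists>y. var i * z - var u * y \<in> J"
    and z': "\<And>i. i \<noteq> u \<Longrightarrow> \<exists>y. var i * z' - var u * y \<in> J"
  shows "\<exists>c c'. (c \<noteq> 0 \<or> c' \<noteq> 0) \<and> (\<exists>y. scale c z + scale c' z' - var u * y \<in> J)"
proof -
  obtain \<phi>s ds where min: "minimal_graded_free_resolution J \<phi>s ds" and last1: "length (last ds) = 1"
    using gor unfolding gorenstein_quot_def by blast
  define p where "p = length \<phi>s"
  have len: "length ds = Suc p" and ds0: "ds ! 0 = [0]"
    and carr: "\<And>i. i < p \<Longrightarrow> \<phi>s ! i \<in> carrier_mat (length (ds ! i)) (length (ds ! Suc i))"
    and ker: "\<And>i. i \<le> p \<Longrightarrow> res_kernel J \<phi>s i = res_image \<phi>s ds i"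
    and irr: "\<And>i. i < p \<Longrightarrow> elements_mat (\<phi>s ! i) \<subseteq> irrelevant_ideal"
    using min unfolding minimal_graded_free_resolution_def graded_free_resolution_def p_def by auto
  define b where "b i = (if i \<le> p then length (ds ! i) else 0)" for i
  define M where "M i l k = (\<phi>s ! i) $$ (l, k)" for i l k
  define D where "D i w l = (\<Sum>k<b (Suc i). M i l k * w k)" for i w l
  have bp: "b p = 1" using last1 len last_conv_nth[of ds] by (cases "ds = []") (auto simp: b_def)
  have carr': "\<phi>s ! i \<in> carrier_mat (b i) (b (Suc i))" if "i < p" for i
    using carr[OF that] that by (simp add: b_def)
  have D_mat: "\<phi>s ! i *\<^sub>v vec (b (Suc i)) w = vec (b i) (D i w)" if "i < p" for i w
    using carr'[OF that] by (intro eq_vecI) (auto simp: scalar_prod_def atLeast0LessThan D_def M_def)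
  have D_mat': "\<phi>s ! i *\<^sub>v w = vec (b i) (D i (($) w))" if "i < p" "w \<in> carrier_vec (b (Suc i))" for i w
  proof -
    have "w = vec (b (Suc i)) (($) w)" using that(2) by auto
    then show ?thesis using D_mat[OF that(1), of "($) w"] by simp
  qed
  have D_zero: "D i w l = 0" if "p \<le> i" for i w l using that by (simp add: D_def b_def)
  have D_zero': "D i w = (\<lambda>_. 0)" if "p \<le> i" for i w using D_zero[OF that] by auto
  have image: "res_image \<phi>s ds i = {vec (b i) (D i w) | w. True}"
    if "i \<le> p" for i
  proof (cases "i < p")
    case True
    then have "res_image \<phi>s ds i = {\<phi>s ! i *\<^sub>v w | w. w \<in> carrier_vec (b (Suc i))}"
      by (simp add: res_image_def p_def b_def)
    also have "\<dots> = {vec (b i) (D i w) | w. True}"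
    proof (rule subset_antisym; rule subsetI)
      fix v assume "v \<in> {\<phi>s ! i *\<^sub>v w | w. w \<in> carrier_vec (b (Suc i))}"
      then show "v \<in> {vec (b i) (D i w) | w. True}" using D_mat'[OF True] by auto
    next
      fix v assume "v \<in> {vec (b i) (D i w) | w. True}"
      then obtain w where "v = \<phi>s ! i *\<^sub>v vec (b (Suc i)) w" using D_mat[OF True] by auto
      then show "v \<in> {\<phi>s ! i *\<^sub>v w | w. w \<in> carrier_vec (b (Suc i))}" using vec_carrier by blast
    qed
    finally show ?thesis using True by simp
  next
    case False
    then show ?thesis using that
      by (simp add: res_image_def D_zero' zero_vec_def) (simp add: p_def b_def)
  qed
  have kernel: "vec (b (Suc i)) v \<in> res_kernel J \<phi>s (Suc i) \<longleftrightarrow> (\<forall>l<b i. D i v l = 0)" if "i < p" for i v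
  proof -
    have "vec (b (Suc i)) v \<in> res_kernel J \<phi>s (Suc i) \<longleftrightarrow> vec (b i) (D i v) = 0\<^sub>v (b i)"
      using carr'[OF that] D_mat[OF that] by (auto simp: res_kernel_def mat_kernel_def)
    also have "\<dots> \<longleftrightarrow> (\<forall>l<b i. D i v l = 0)" by (auto simp: vec_eq_iff)
    finally show ?thesis .
  qed
  have b0: "b 0 = 1" using ds0 by (simp add: b_def)
  define s where "s = card (UNIV :: 'w set) - 1"
  have Suc_s: "Suc s = card (UNIV :: 'w set)" unfolding s_def using finite_UNIV_card_ge_0[where 'a='w] by simp
  obtain e :: "nat \<Rightarrow> 'w" where e: "e 0 = u" "inj_on e {..<Suc s}" "e ` {..<Suc s} = UNIV"
    using enumerate_from unfolding Suc_s by blast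
  define Q :: "nat \<Rightarrow> ('w, 'a) mpoly set" where "Q n = vars_ideal (e ` {..<n})" for n
  have Q_top: "Q (Suc s) = irrelevant_ideal" by (simp only: Q_def e irrelevant_ideal_eq_vars_ideal)
  interpret K: resolution_along_sequence b M J Q "\<lambda>k. var (e k)" s D
  proof
    show "D i w l = (\<Sum>k<b (Suc i). M i l k * w k)" for i w l by (simp add: D_def)
    show "b 0 = 1" by (fact b0)
    show "D 0 w 0 \<in> J" for w
    proof -
      have "vec (b 0) (D 0 w) \<in> res_image \<phi>s ds 0"
        by (auto simp: image)
      then have "vec 1 (D 0 w) \<in> res_kernel J \<phi>s 0" using ker[of 0] b0 by simp
      then show ?thesis by (simp add: res_kernel_def)
    qed
    show "\<exists>w. D 0 w 0 = f" if "f \<in> J" for f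
    proof -
      have "vec 1 (\<lambda>_. f) \<in> res_kernel J \<phi>s 0" using that by (simp add: res_kernel_def)
      then have "vec 1 (\<lambda>_. f) \<in> res_image \<phi>s ds 0" using ker[of 0] by simp
      then obtain w where w: "vec 1 (\<lambda>_. f) = vec (b 0) (D 0 w)"
        by (auto simp: image)
      have "vec 1 (\<lambda>_. f) $ 0 = vec (b 0) (D 0 w) $ 0" unfolding w ..
      then show ?thesis using b0 by auto
    qed
    show "D i (D (Suc i) w) l = 0" if l: "l < b i" for l i w
    proof (cases "Suc i < p")
      case True
      then have "vec (b (Suc i)) (D (Suc i) w) \<in> res_image \<phi>s ds (Suc i)" by (auto simp: image)
      then show ?thesis using True kernel[of i "D (Suc i) w"] ker[of "Suc i"] l by simp
    next
      case False
      then have "D (Suc i) w = (\<lambda>_. 0)" by (intro D_zero') simp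
      then show ?thesis by (simp add: D_def)
    qed
    show "\<exists>w. \<forall>l<b (Suc i). v l = D (Suc i) w l" if "\<And>l. l < b i \<Longrightarrow> D i v l = 0" for i v
    proof (cases "i < p")
      case True
      then have "vec (b (Suc i)) v \<in> res_image \<phi>s ds (Suc i)"
        using that kernel[of i v] ker[of "Suc i"] by simp
      then obtain w where w: "vec (b (Suc i)) v = vec (b (Suc i)) (D (Suc i) w)"
        using True by (auto simp: image)
      have "v l = D (Suc i) w l" if "l < b (Suc i)" for l
        using arg_cong[OF w, of "\<lambda>v. v $ l"] that by simp
      then show ?thesis by blast
    qed (simp add: b_def)
    show "ring_ideal.subspace (Q n)" for n unfolding Q_def by (rule subspace_vars_ideal)
    show "Q 0 = {0}" by (simp add: Q_def vars_ideal_empty)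
    show "Q (Suc n) = {q + var (e n) * y | q y. q \<in> Q n}" for n
      unfolding Q_def lessThan_Suc image_insert by (rule vars_ideal_insert)
    show "y \<in> Q n" if "n \<le> s" "var (e n) * y \<in> Q n" for n y
    proof -
      have "e n \<notin> e ` {..<n}" using e(2) that(1) by (auto dest!: inj_onD[OF e(2)])
      with that(2) show ?thesis unfolding Q_def by (rule var_regular_mod_vars_ideal)
    qed
    show "y \<in> J" if "var (e 0) * y \<in> J" for y using reg that e by simp
    show "M i l k \<in> Q (Suc s)" if "l < b i" "k < b (Suc i)" for i l k
    proof -
      have "i < p" using that(2) by (cases "i < p") (auto simp: b_def)
      moreover have "(\<phi>s ! i) $$ (l, k) \<in> elements_mat (\<phi>s ! i)"
        using carr'[OF \<open>i < p\<close>] that by (auto intro!: elements_matI)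
      ultimately show ?thesis using irr[of i] unfolding Q_top M_def by blast
    qed
  qed
  have one: "1 \<notin> Q (Suc s)" unfolding Q_top irrelevant_ideal_def by simp
  have "s \<le> p \<Longrightarrow> b s \<le> 1"
    using K.rank_zero_beyond[OF one, of p] bp by (cases "s = p") (auto simp: b_def)
  then have top: "b s \<le> 1" by (cases "s \<le> p") (auto simp: b_def)
  define C :: "('w, 'a) mpoly set" where "C = range (Poly_Mapping.single 0)"
  have C1: "\<exists>c\<in>C. g - c \<in> Q (Suc s)" for g
    unfolding C_def Q_top irrelevant_ideal_def
    by (auto simp: lookup_minus intro!: exI[of _ "lookup g 0"])
  have C2: "0 \<in> C" unfolding C_def using single_zero[of 0] by (metis rangeI)
  have C3: "1 \<in> C" unfolding C_def using single_one by (metis rangeI)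
  have C4: "- c \<in> C" if "c \<in> C" for c
    using that unfolding C_def by (auto simp: single_uminus[symmetric])
  have ne_u: "e i \<noteq> u" if "0 < i" "i \<le> s" for i
    using inj_onD[OF e(2), of i 0] e(1) that by auto
  have "\<exists>c\<in>C. \<exists>c'\<in>C. (c \<noteq> 0 \<or> c' \<noteq> 0) \<and> c * z + c' * z' \<in> K.J_plus"
    using z z' e(1) ne_u
    by (intro K.socle_relation[OF top C1 C2 C3 C4]) (auto simp: K.J_plus_def)
  then obtain c c' y where "Poly_Mapping.single 0 c \<noteq> (0 :: ('w, 'a) mpoly) \<or> Poly_Mapping.single 0 c' \<noteq> (0 :: ('w, 'a) mpoly)"
    and rel: "scale c z + scale c' z' - var u * y \<in> J"
    unfolding C_def K.J_plus_def scale_def e(1) by blast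
  then have "c \<noteq> 0 \<or> c' \<noteq> 0" by auto
  with rel show ?thesis by blast
qed

section \<open>Evaluation, degree and homogenization\<close>

lemma peval_add: "peval (f + g) x = peval f x + peval g x"
  unfolding peval_def
  by (rule setsum_keys_plus_distrib) (simp_all add: distrib_right)

lemma peval_single:
  "peval (Poly_Mapping.single a c) x = c * (\<Prod>i\<in>UNIV. x i ^ lookup a i)"
  by (simp add: peval_def)

lemma peval_zero: "peval 0 x = 0"
  by (simp add: peval_def)

lemma peval_diff: "peval (f - g) x = peval f x - peval g x"
  using peval_add[of "f - g" g x] by (simp add: algebra_simps)

lemma peval_mult: "peval (f * g) x = peval f x * peval g x"
proof (induction f rule: mpoly_induct)
  case (single a c)
  show ?case
  proof (induction g rule: mpoly_induct)
    case (single b k)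
    show ?case
      by (simp add: mult_single peval_single lookup_add power_add prod.distrib ac_simps)
  qed (simp add: distrib_left peval_add)
qed (simp add: distrib_right peval_add)

lemma peval_one: "peval 1 x = 1"
  using peval_single[of 0 1 x] by simp

lemma peval_const: "peval (Poly_Mapping.single 0 c) x = c"
  by (simp add: peval_single)

lemma peval_scale: "peval (scale c f) x = c * peval f x"
  by (simp add: scale_def peval_mult peval_const)

lemma peval_sum: "peval (sum f A) x = (\<Sum>a\<in>A. peval (f a) x)"
  by (induction A rule: infinite_finite_induct) (simp_all add: peval_zero peval_add)

lemma peval_prod: "peval (prod f A) x = (\<Prod>a\<in>A. peval (f a) x)"
  by (induction A rule: infinite_finite_induct) (simp_all add: peval_one peval_mult)

lemma peval_var: "peval (var i) x = x i"
proof -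
  have "(\<Prod>k\<in>UNIV. x k ^ lookup (Poly_Mapping.single i 1) k) = (\<Prod>k\<in>UNIV. if k = i then x k else 1)"
    by (intro prod.cong) (auto simp: lookup_single when_def)
  then show ?thesis by (simp add: var_def peval_single)
qed

lemma subspace_vanishing_ideal: "ring_ideal.subspace (vanishing_ideal X)"
  by (rule ring_ideal.subspaceI) (auto simp: vanishing_ideal_def peval_zero peval_add peval_mult)

lemma ideal_scale: "ring_ideal.subspace I \<Longrightarrow> f \<in> I \<Longrightarrow> scale c f \<in> I"
  unfolding scale_def by (rule ring_ideal.subspace_scale)

lemma lookup_scale: "lookup (scale c f) a = c * lookup f a"
  using lookup_single_mult[of 0 c f a] by (simp add: scale_def)

lemma mon_deg_add: "mon_deg (a + b) = mon_deg a + mon_deg b"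
  by (simp add: mon_deg_def lookup_add sum.distrib)

lemma mon_deg_zero: "mon_deg 0 = 0"
  by (simp add: mon_deg_def)

lemma mon_deg_single: "mon_deg (Poly_Mapping.single i n) = n"
  by (simp add: mon_deg_def lookup_single when_def)

lemma finite_mon_deg_le: "finite {a :: 'v::finite mon. mon_deg a \<le> d}"
proof (rule finite_imageD)
  have "lookup a i \<le> mon_deg a" for a :: "'v mon" and i
    unfolding mon_deg_def by (rule member_le_sum) auto
  then have "lookup ` {a :: 'v mon. mon_deg a \<le> d} \<subseteq> PiE UNIV (\<lambda>_. {..d})"
    by (auto intro: order_trans)
  then show "finite (lookup ` {a :: 'v mon. mon_deg a \<le> d})"
    by (rule finite_subset) (auto intro: finite_PiE)
  show "inj_on lookup {a :: 'v mon. mon_deg a \<le> d}"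
    by (auto intro!: inj_onI poly_mapping_eqI)
qed

lemma subspace_polys_le: "mpoly.subspace (polys_le d :: ('v::finite, 'a::field) mpoly set)"
proof (rule mpoly.subspaceI)
  fix f g :: "('v, 'a) mpoly" assume "f \<in> polys_le d" "g \<in> polys_le d"
  then show "f + g \<in> polys_le d" using keys_add[of f g] by (auto simp: polys_le_def)
next
  fix c and f :: "('v, 'a) mpoly" assume "f \<in> polys_le d"
  then show "scale c f \<in> polys_le d" by (auto simp: polys_le_def in_keys_iff lookup_scale)
qed (simp add: polys_le_def)

lemma polys_le_mult:
  "f \<in> polys_le d \<Longrightarrow> g \<in> polys_le e \<Longrightarrow> f * g \<in> polys_le (d + e)"
  using keys_mult[of f g] by (fastforce simp: polys_le_def mon_deg_add)

lemma polys_le_mono: "d \<le> e \<Longrightarrow> polys_le d \<subseteq> polys_le e"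
  by (auto simp: polys_le_def)

lemma polys_le_neg: "d < 0 \<Longrightarrow> polys_le d = {0}"
  by (force simp: polys_le_def)

lemma var_polys_le: "(var i :: ('v::finite, 'a::comm_ring_1) mpoly) \<in> polys_le 1"
  by (simp add: polys_le_def var_def mon_deg_single)

lemma single_polys_le: "int (mon_deg a) \<le> d \<Longrightarrow> Poly_Mapping.single a c \<in> polys_le d"
  by (simp add: polys_le_def)

lemma polys_le_total_deg: "f \<in> polys_le (int (total_deg f))"
  by (auto simp: polys_le_def total_deg_def)

lemma total_deg_le: "f \<in> polys_le (int d) \<Longrightarrow> total_deg f \<le> d"
  by (auto simp: polys_le_def total_deg_def)

text \<open>Monomials of degree at most \<open>d\<close> suffice in an induction over polynomials of degree at most \<open>d\<close>;
  homogenization to degree \<open>d\<close> behaves well only for these.\<close>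

lemma polys_le_induct [consumes 1, case_names single add]:
  assumes "f \<in> polys_le (int d)"
    and "\<And>a c. mon_deg a \<le> d \<Longrightarrow> Q (Poly_Mapping.single a c)"
    and "\<And>f g. Q f \<Longrightarrow> Q g \<Longrightarrow> Q (f + g)"
  shows "Q (f :: ('v::finite, 'a::comm_monoid_add) mpoly)"
proof -
  have "Q (\<Sum>a\<in>A. Poly_Mapping.single a (lookup f a))"
    if "finite A" "\<forall>a\<in>A. mon_deg a \<le> d" for A
    using that
  proof induction
    case empty
    show ?case using assms(2)[of 0 0] by (simp add: mon_deg_zero)
  qed (simp add: assms)
  from this[OF finite_keys[of f]] show ?thesis
    using mpoly_eq_sum[of f] assms(1) by (simp add: polys_le_def)
qed

abbreviation strip :: "'v option mon \<Rightarrow> 'v mon" where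
  "strip \<equiv> Poly_Mapping.map_key Some"

lemma lookup_strip: "lookup (strip c) i = lookup c (Some i)"
  by (simp add: map_key.rep_eq)

lemma lookup_homogenize_mon:
  "lookup (homogenize_mon e a) (Some i) = lookup a i"
  "lookup (homogenize_mon e a) None = e - mon_deg a"
  by (simp_all add: homogenize_mon_def lookup_add lookup_sum lookup_single when_def)

lemma mon_deg_option: "mon_deg c = lookup c None + mon_deg (strip c)"
  for c :: "'v::finite option mon"
  by (simp add: mon_deg_def UNIV_option_conv sum.reindex lookup_strip)

lemma strip_homogenize_mon: "strip (homogenize_mon e a) = a"
  by (rule poly_mapping_eqI) (simp add: lookup_strip lookup_homogenize_mon)

lemma mon_deg_homogenize_mon: "mon_deg a \<le> e \<Longrightarrow> mon_deg (homogenize_mon e a) = e"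
  by (simp add: mon_deg_option lookup_homogenize_mon strip_homogenize_mon)

lemma homogenize_mon_strip: "homogenize_mon (mon_deg c) (strip c) = c"
proof (rule poly_mapping_eqI)
  fix i show "lookup (homogenize_mon (mon_deg c) (strip c)) i = lookup c i"
    by (cases i) (simp_all add: lookup_homogenize_mon lookup_strip mon_deg_option[of c])
qed

lemma homogenize_mon_shift:
  assumes "mon_deg a \<le> e" "e \<le> d"
  shows "Poly_Mapping.single None (d - e) + homogenize_mon e a = homogenize_mon d a"
proof (rule poly_mapping_eqI)
  fix i show "lookup (Poly_Mapping.single None (d - e) + homogenize_mon e a) i
      = lookup (homogenize_mon d a) i"
    using assms by (cases i) (simp_all add: lookup_add lookup_single lookup_homogenize_mon)
qed

lemma strip_add: "strip (a + b) = strip a + strip b"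
  by (simp add: map_key_plus)

lemma strip_single_None: "strip (Poly_Mapping.single None n) = 0"
  by (rule poly_mapping_eqI) (simp add: lookup_strip lookup_single)

lemma strip_single_Some: "strip (Poly_Mapping.single (Some i) n) = Poly_Mapping.single i n"
  by (rule poly_mapping_eqI) (simp add: lookup_strip lookup_single when_def)

text \<open>The homogeneous part of degree \<open>d\<close>, with \<open>u = 1\<close>. Keeping the degree makes this an isomorphism from
  the forms of degree \<open>d\<close> to the polynomials of degree at most \<open>d\<close>, with inverse \<open>hom_to d\<close>.\<close>

definition dehom :: "nat \<Rightarrow> ('v::finite option, 'a::comm_ring_1) mpoly \<Rightarrow> ('v, 'a) mpoly" where
  "dehom d F = (\<Sum>c\<in>keys F. if mon_deg c = d then Poly_Mapping.single (strip c) (lookup F c) else 0)"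

definition hom_to :: "nat \<Rightarrow> ('v::finite, 'a::comm_ring_1) mpoly \<Rightarrow> ('v option, 'a) mpoly" where
  "hom_to d f = (\<Sum>a\<in>keys f. Poly_Mapping.single (homogenize_mon d a) (lookup f a))"

lemma dehom_add: "dehom d (F + G) = dehom d F + dehom d G"
  unfolding dehom_def by (rule setsum_keys_plus_distrib) (simp_all add: single_add)

lemma dehom_single:
  "dehom d (Poly_Mapping.single c k) = (if mon_deg c = d then Poly_Mapping.single (strip c) k else 0)"
  by (simp add: dehom_def)

lemma dehom_diff: "dehom d (F - G) = dehom d F - dehom d G"
  using dehom_add[of d "F - G" G] by (simp add: algebra_simps)

lemma dehom_zero: "dehom d 0 = 0"
  by (simp add: dehom_def)

lemma dehom_scale: "dehom d (scale k F) = scale k (dehom d F)"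
  unfolding scale_def
  by (induction F rule: mpoly_induct)
     (simp_all add: distrib_left dehom_add mult_single dehom_single)

lemma dehom_polys_le: "dehom d F \<in> polys_le (int d)" for F :: "('v::finite option, 'a::field) mpoly"
proof (induction F rule: mpoly_induct)
  case (single c k)
  then show ?case
    using mpoly.subspace_0[OF subspace_polys_le]
    by (auto simp: dehom_single mon_deg_option[of c] intro!: single_polys_le)
qed (simp add: dehom_add mpoly.subspace_add[OF subspace_polys_le])

lemma hom_to_add: "hom_to d (f + g) = hom_to d f + hom_to d g"
  unfolding hom_to_def by (rule setsum_keys_plus_distrib) (simp_all add: single_add)

lemma hom_to_zero: "hom_to d 0 = 0"
  by (simp add: hom_to_def)

lemma hom_to_single: "hom_to d (Poly_Mapping.single a k) = Poly_Mapping.single (homogenize_mon d a) k"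
  by (simp add: hom_to_def)

text \<open>All dehomogenizations below reduce to this one computation.\<close>

lemma dehom_single_mult_hom_to:
  assumes "f \<in> polys_le (int d)"
  shows "dehom e (Poly_Mapping.single c k * hom_to d f)
    = (if mon_deg c + d = e then Poly_Mapping.single (strip c) k * f else 0)"
  using assms
  by (induction f rule: polys_le_induct)
     (simp_all add: hom_to_single hom_to_add mult_single dehom_single mon_deg_add strip_add
       mon_deg_homogenize_mon strip_homogenize_mon distrib_left dehom_add)

lemma dehom_hom_to:
  assumes "f \<in> polys_le (int d)"
  shows "dehom e (hom_to d f) = (if d = e then f else 0)"
  using dehom_single_mult_hom_to[OF assms, of e 0 1] strip_single_None[of 0]
  by (simp add: mon_deg_zero)

lemma dehom_var_None: "dehom d (var None * F) = (if d = 0 then 0 else dehom (d - 1) F)"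
  unfolding var_def
  by (induction F rule: mpoly_induct)
     (auto simp: mult_single dehom_single mon_deg_add mon_deg_single strip_add strip_single_None
       distrib_left dehom_add)

lemma sum_hom_to_dehom:
  fixes F :: "('v::finite option, 'a::comm_ring_1) mpoly"
  shows "(\<Sum>d\<in>mon_deg ` keys F. hom_to d (dehom d F)) = F"
proof -
  have hom_sum: "hom_to d (sum f A) = (\<Sum>c\<in>A. hom_to d (f c))"
    for d and f :: "'v option mon \<Rightarrow> ('v, 'a) mpoly" and A
    by (induction A rule: infinite_finite_induct) (simp_all add: hom_to_zero hom_to_add)
  have "hom_to d (dehom d F) = (\<Sum>c\<in>keys F. if d = mon_deg c then Poly_Mapping.single c (lookup F c) else 0)" for d
    unfolding dehom_def hom_sum
    by (intro sum.cong) (auto simp: hom_to_single homogenize_mon_strip hom_to_zero)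
  then have "(\<Sum>d\<in>mon_deg ` keys F. hom_to d (dehom d F)) =
    (\<Sum>d\<in>mon_deg ` keys F. \<Sum>c\<in>keys F. if d = mon_deg c then Poly_Mapping.single c (lookup F c) else 0)"
    by simp
  also have "\<dots> = (\<Sum>c\<in>keys F. \<Sum>d\<in>mon_deg ` keys F. if d = mon_deg c then Poly_Mapping.single c (lookup F c) else 0)"
    by (rule sum.swap)
  also have "\<dots> = (\<Sum>c\<in>keys F. Poly_Mapping.single c (lookup F c))"
    by (intro sum.cong) auto
  finally show ?thesis using mpoly_eq_sum[of F] by simp
qed

lemma hom_to_eq_homogenize:
  assumes "f \<in> polys_le (int d)"
  shows "hom_to d f = Poly_Mapping.single (Poly_Mapping.single None (d - total_deg f)) 1 * homogenize f"
proof -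
  have "mon_deg a \<le> total_deg f" if "a \<in> keys f" for a
    using polys_le_total_deg[of f] that by (auto simp: polys_le_def)
  then show ?thesis
    using total_deg_le[OF assms]
    by (simp add: hom_to_def homogenize_def sum_distrib_left mult_single homogenize_mon_shift)
qed

text \<open>The homogenized ideal is homogeneous, and its forms of degree \<open>d\<close> are the \<open>u\<^sup>d f(t / u)\<close> with \<open>f \<in> I\<close> of
  degree at most \<open>d\<close>, that is, the multiples of \<open>f\<^sup>h\<close> by powers of \<open>u\<close>. In particular \<open>u\<close> is regular
  modulo it.\<close>

lemma homogenize_ideal_iff:
  assumes I: "ring_ideal.subspace I"
  shows "F \<in> homogenize_ideal I \<longleftrightarrow> (\<forall>d. dehom d F \<in> I)"
proof
  assume F: "F \<in> homogenize_ideal I"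
  let ?J = "{F. \<forall>d. dehom d F \<in> I}"
  have "G * homogenize f \<in> ?J" if f: "f \<in> I" for G f
  proof (induction G rule: mpoly_induct)
    case (single c k)
    have "homogenize f = hom_to (total_deg f) f" by (simp add: homogenize_def hom_to_def)
    then show ?case
      using dehom_single_mult_hom_to[OF polys_le_total_deg[of f], of _ c k]
        ring_ideal.subspace_scale[OF I f] ring_ideal.subspace_0[OF I] by simp
  next
    case (add G1 G2)
    then show ?case using ring_ideal.subspace_add[OF I] by (simp add: distrib_right dehom_add)
  qed
  then have "G * H \<in> ?J" if "H \<in> homogenize ` I" for G H using that by blast
  have "F \<in> ?J"
    using F unfolding homogenize_ideal_def
  proof (induction rule: ring_ideal.span_induct_alt)
    case base
    show ?case using ring_ideal.subspace_0[OF I] by (simp add: dehom_zero)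
  next
    case (step c x y)
    then show ?case using \<open>\<And>H G. H \<in> homogenize ` I \<Longrightarrow> G * H \<in> ?J\<close>[of x c] ring_ideal.subspace_add[OF I]
      by (simp add: dehom_add)
  qed
  then show "\<forall>d. dehom d F \<in> I" by simp
next
  assume *: "\<forall>d. dehom d F \<in> I"
  have "hom_to d (dehom d F) \<in> homogenize_ideal I" for d
    unfolding hom_to_eq_homogenize[OF dehom_polys_le] homogenize_ideal_def
    using * by (intro ring_ideal.span_scale ring_ideal.span_base) auto
  then have "(\<Sum>d\<in>mon_deg ` keys F. hom_to d (dehom d F)) \<in> homogenize_ideal I"
    unfolding homogenize_ideal_def by (intro ring_ideal.span_sum)
  then show "F \<in> homogenize_ideal I" by (simp only: sum_hom_to_dehom)
qed

text \<open>The one-dimensional socle in affine terms. The assumption on \<open>f\<close> says that all \<open>t\<^sub>i f\<close> have degree at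
  most \<open>d\<close> modulo \<open>I\<close>, so that the form \<open>u\<^sup>d f(t / u)\<close> is killed by the variables modulo \<open>(I\<^sup>h, u)\<close>. The
  resulting linear relation is homogeneous only for \<open>d = e\<close>; taking its parts of degrees
  \<open>d\<close> and \<open>e\<close> separately gives the two conclusions.\<close>

lemma affine_socle_relation:
  fixes I :: "('v::finite, 'a::field) mpoly set"
  assumes I: "ring_ideal.subspace I" and gor: "gorenstein_affine I"
    and f: "f \<in> polys_le (int d)" "\<And>i. \<exists>h\<in>polys_le (int d). var i * f - h \<in> I"
    and g: "g \<in> polys_le (int e)" "\<And>i. \<exists>h\<in>polys_le (int e). var i * g - h \<in> I"
  shows "\<exists>c c'. (c \<noteq> 0 \<or> c' \<noteq> 0) \<and>
    (\<exists>h\<in>polys_le (int d - 1). scale c f + (if e = d then scale c' g else 0) - h \<in> I) \<and>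
    (\<exists>h\<in>polys_le (int e - 1). (if d = e then scale c f else 0) + scale c' g - h \<in> I)"
proof -
  let ?J = "homogenize_ideal I"
  note J = homogenize_ideal_iff[OF I]
  have reg: "F \<in> ?J" if "var None * F \<in> ?J" for F
    unfolding J
  proof
    fix d show "dehom d F \<in> I"
      using that[unfolded J, rule_format, of "Suc d"] by (simp add: dehom_var_None)
  qed
  have soc: "\<exists>y. var i * hom_to n q - var None * y \<in> ?J"
    if "i \<noteq> None" and q: "q \<in> polys_le (int n)" and q': "\<And>i. \<exists>h\<in>polys_le (int n). var i * q - h \<in> I"
    for i n and q :: "('v, 'a) mpoly"
  proof -
    obtain j where i: "i = Some j" using \<open>i \<noteq> None\<close> by auto
    obtain h where h: "h \<in> polys_le (int n)" "var j * q - h \<in> I" using q' by blast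
    \<comment> \<open>The form \<open>t\<^sub>j u\<^sup>n q(t / u) - u u\<^sup>n h(t / u)\<close> has degree \<open>n + 1\<close> and
      dehomogenizes to \<open>t\<^sub>j q - h \<in> I\<close>.\<close>
    have "dehom k (var i * hom_to n q - var None * hom_to n h) = (if Suc n = k then var j * q - h else 0)" for k
      unfolding dehom_diff var_def dehom_single_mult_hom_to[OF q] dehom_single_mult_hom_to[OF h(1)]
      by (simp add: mon_deg_single strip_single_None strip_single_Some i)
    then have "var i * hom_to n q - var None * hom_to n h \<in> ?J"
      unfolding J using h(2) ring_ideal.subspace_0[OF I] by simp
    then show ?thesis by blast
  qed
  obtain c c' y where c: "c \<noteq> 0 \<or> c' \<noteq> 0"
    and y: "scale c (hom_to d f) + scale c' (hom_to e g) - var None * y \<in> ?J"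
    using gorenstein_socle_relation[OF gor[unfolded gorenstein_affine_def] reg
        soc[OF _ f] soc[OF _ g]] by blast
  have low: "dehom k (var None * y) \<in> polys_le (int k - 1)" for k
    using dehom_polys_le[of "k - 1" y] mpoly.subspace_0[OF subspace_polys_le]
    by (auto simp: dehom_var_None of_nat_diff)
  have comb: "scale c (if d = k then f else 0) + scale c' (if e = k then g else 0) - dehom k (var None * y) \<in> I" for k
    using y[unfolded J, rule_format, of k]
    by (simp add: dehom_diff dehom_add dehom_scale dehom_hom_to[OF f(1)] dehom_hom_to[OF g(1)])
  have "\<exists>h\<in>polys_le (int d - 1). scale c f + (if e = d then scale c' g else 0) - h \<in> I"
    using comb[of d] low[of d] by (intro bexI[of _ "dehom d (var None * y)"]) (auto simp: scale_def)
  moreover have "\<exists>h\<in>polys_le (int e - 1). (if d = e then scale c f else 0) + scale c' g - h \<in> I"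
    using comb[of e] low[of e] by (intro bexI[of _ "dehom e (var None * y)"]) (auto simp: scale_def)
  ultimately show ?thesis using c by blast
qed

section \<open>Standard monomials\<close>

lemma monomial_order_irrefl: "monomial_order prec \<Longrightarrow> \<not> prec a a"
  by (simp add: monomial_order_def irreflp_def)

lemma monomial_order_trans: "monomial_order prec \<Longrightarrow> prec a b \<Longrightarrow> prec b c \<Longrightarrow> prec a c"
  unfolding monomial_order_def transp_def by blast

lemma monomial_order_total: "monomial_order prec \<Longrightarrow> a \<noteq> b \<Longrightarrow> prec a b \<or> prec b a"
  unfolding monomial_order_def totalp_on_def by blast

lemma lead_mon_props:
  assumes "monomial_order prec" "f \<noteq> 0"
  shows lead_mon_in_keys: "lead_mon prec f \<in> keys f"
    and lead_mon_greatest: "b \<in> keys f \<Longrightarrow> b \<noteq> lead_mon prec f \<Longrightarrow> prec b (lead_mon prec f)"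
proof -
  note irr = monomial_order_irrefl[OF assms(1)] and trans = monomial_order_trans[OF assms(1)]
    and tot = monomial_order_total[OF assms(1)]
  have max: "A \<noteq> {} \<Longrightarrow> \<exists>a\<in>A. \<forall>b\<in>A. b \<noteq> a \<longrightarrow> prec b a" if "finite A" for A
    using that
  proof (induction A)
    case (insert c A)
    show ?case
    proof (cases "A = {}")
      case False
      then obtain a where a: "a \<in> A" "\<forall>b\<in>A. b \<noteq> a \<longrightarrow> prec b a" using insert.IH by blast
      show ?thesis
      proof (cases "prec a c")
        case True
        have "prec b c" if "b \<in> insert c A" "b \<noteq> c" for b
          using that a True trans[of b a c] by (cases "b = a") auto
        then show ?thesis by blast
      next
        case False
        then have "prec b a" if "b \<in> insert c A" "b \<noteq> a" for b
          using that a tot[of a c] by auto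
        then show ?thesis using a(1) by blast
      qed
    qed simp
  qed simp
  have "keys f \<noteq> {}" using assms(2) by simp
  then obtain a where a: "a \<in> keys f" "\<forall>b\<in>keys f. b \<noteq> a \<longrightarrow> prec b a"
    using max[OF finite_keys] by blast
  have "lead_mon prec f = a"
    unfolding lead_mon_def
  proof (rule the_equality)
    fix c assume c: "c \<in> keys f \<and> (\<forall>b\<in>keys f. b \<noteq> c \<longrightarrow> prec b c)"
    show "c = a"
    proof (rule ccontr)
      assume "c \<noteq> a"
      then have "prec a c" "prec c a" using a c by auto
      then show False using trans[of a c a] irr by blast
    qed
  qed (use a in blast)
  with a show "lead_mon prec f \<in> keys f"
    and "b \<in> keys f \<Longrightarrow> b \<noteq> lead_mon prec f \<Longrightarrow> prec b (lead_mon prec f)" by auto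
qed

text \<open>The exponent vectors behind \<^const>\<open>standard_monomials\<close>.\<close>

definition standard_mon :: "('v mon \<Rightarrow> 'v mon \<Rightarrow> bool) \<Rightarrow> ('v, 'a::field) mpoly set \<Rightarrow> 'v mon \<Rightarrow> bool" where
  "standard_mon prec I a \<longleftrightarrow> Poly_Mapping.single a 1 \<notin> initial_ideal prec I"

lemma lead_mon_not_standard:
  "f \<in> I \<Longrightarrow> f \<noteq> 0 \<Longrightarrow> \<not> standard_mon prec I (lead_mon prec f)"
  unfolding standard_mon_def initial_ideal_def by (auto intro: ring_ideal.span_base)

text \<open>Every monomial of the initial ideal is a multiple of a leading monomial, and the order is compatible
  with multiplication, so it is itself a leading monomial.\<close>

lemma not_standard_witness:
  fixes I :: "('v, 'a::field) mpoly set"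
  assumes ord: "monomial_order prec" and I: "ring_ideal.subspace I" and "\<not> standard_mon prec I a"
  shows "\<exists>g\<in>I. lookup g a = 1 \<and> (\<forall>b\<in>keys g. b = a \<or> prec b a)"
proof -
  let ?T = "{F :: ('v, 'a) mpoly. \<forall>b\<in>keys F. \<exists>f\<in>I - {0}. \<exists>c. b = c + lead_mon prec f}"
  have "ring_ideal.subspace ?T"
  proof (rule ring_ideal.subspaceI)
    fix F G assume "F \<in> ?T" "G \<in> ?T"
    then show "F + G \<in> ?T" using keys_add[of F G] by auto
  next
    fix F G assume G: "G \<in> ?T"
    show "F * G \<in> ?T"
    proof (intro CollectI ballI)
      fix b assume "b \<in> keys (F * G)"
      then obtain b1 b2 where b: "b = b1 + b2" "b2 \<in> keys G" using keys_mult[of F G] by blast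
      then obtain f c where "f \<in> I - {0}" "b2 = c + lead_mon prec f" using G by blast
      then show "\<exists>f\<in>I - {0}. \<exists>c. b = c + lead_mon prec f"
        using b(1) by (intro bexI[of _ f] exI[of _ "b1 + c"]) (simp_all add: add.assoc)
    qed
  qed simp
  moreover have "(\<lambda>f. Poly_Mapping.single (lead_mon prec f) 1) ` (I - {0}) \<subseteq> ?T"
  proof
    fix F assume "F \<in> (\<lambda>f. Poly_Mapping.single (lead_mon prec f) (1::'a)) ` (I - {0})"
    then obtain f where f: "f \<in> I - {0}" "F = Poly_Mapping.single (lead_mon prec f) 1" by blast
    have "\<exists>c. lead_mon prec f = c + lead_mon prec f" by (rule exI[of _ 0]) simp
    with f(1) have "\<exists>g\<in>I - {0}. \<exists>c. lead_mon prec f = c + lead_mon prec g" by blast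
    then show "F \<in> ?T" using f(2) by simp
  qed
  ultimately have "initial_ideal prec I \<subseteq> ?T"
    unfolding initial_ideal_def by (intro ring_ideal.span_minimal)
  then have "Poly_Mapping.single a 1 \<in> ?T" using assms(3) unfolding standard_mon_def by blast
  then obtain f c where f: "f \<in> I" "f \<noteq> 0" and a: "a = c + lead_mon prec f" by auto
  let ?k = "lookup f (lead_mon prec f)"
  have k: "?k \<noteq> 0" using lead_mon_in_keys[OF ord f(2)] by (simp add: in_keys_iff)
  define g where "g = Poly_Mapping.single c (1 / ?k) * f"
  have "g \<in> I" unfolding g_def by (rule ring_ideal.subspace_scale[OF I f(1)])
  moreover have "lookup g a = 1" using k by (simp add: g_def a lookup_single_mult)
  moreover have "b = a \<or> prec b a" if "b \<in> keys g" for b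
  proof -
    have "b \<in> {x + y |x y. x \<in> keys (Poly_Mapping.single c (1 / ?k)) \<and> y \<in> keys f}"
      using that keys_mult[of "Poly_Mapping.single c (1 / ?k)" f] unfolding g_def by blast
    then obtain y where y: "b = c + y" "y \<in> keys f" using k by auto
    show ?thesis
    proof (cases "y = lead_mon prec f")
      case False
      then have "prec y (lead_mon prec f)" using lead_mon_greatest[OF ord f(2) y(2)] by simp
      then have "prec (y + c) (lead_mon prec f + c)" using ord unfolding monomial_order_def by blast
      then show ?thesis by (simp add: y a add.commute)
    qed (simp add: y a)
  qed
  ultimately show ?thesis by blast
qed

lemma standard_span_iff:
  "f \<in> standard_span prec I \<longleftrightarrow> (\<forall>a\<in>keys f. standard_mon prec I a)"
proof
  let ?T = "{f :: ('a, 'b) mpoly. \<forall>a\<in>keys f. standard_mon prec I a}"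
  have "mpoly.subspace ?T"
  proof (rule mpoly.subspaceI)
    fix f g assume "f \<in> ?T" "g \<in> ?T"
    then show "f + g \<in> ?T" using keys_add[of f g] by auto
  qed (auto simp: in_keys_iff lookup_scale)
  moreover have "standard_monomials prec I \<subseteq> ?T"
    by (auto simp: standard_monomials_def standard_mon_def)
  ultimately have "standard_span prec I \<subseteq> ?T"
    unfolding standard_span_def by (intro mpoly.span_minimal)
  then show "f \<in> standard_span prec I \<Longrightarrow> \<forall>a\<in>keys f. standard_mon prec I a" by blast
next
  assume f: "\<forall>a\<in>keys f. standard_mon prec I a"
  have "Poly_Mapping.single a (lookup f a) \<in> standard_span prec I" if "a \<in> keys f" for a
  proof -
    have "Poly_Mapping.single a 1 \<in> standard_monomials prec I"
      using f that by (auto simp: standard_monomials_def standard_mon_def)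
    then have "scale (lookup f a) (Poly_Mapping.single a 1) \<in> standard_span prec I"
      unfolding standard_span_def by (intro mpoly.span_scale mpoly.span_base)
    then show ?thesis by (simp add: scale_def mult_single)
  qed
  then have "(\<Sum>a\<in>keys f. Poly_Mapping.single a (lookup f a)) \<in> standard_span prec I"
    unfolding standard_span_def by (intro mpoly.span_sum)
  then show "f \<in> standard_span prec I" using mpoly_eq_sum[of f] by simp
qed

lemma subspace_standard_span: "mpoly.subspace (standard_span prec I)"
  unfolding standard_span_def by (rule mpoly.subspace_span)

lemma standard_span_Int_ideal:
  assumes "monomial_order prec" "f \<in> standard_span prec I" "f \<in> I"
  shows "f = 0"
  using lead_mon_not_standard[OF assms(3)] lead_mon_in_keys[OF assms(1)] assms(2)
  unfolding standard_span_iff by blast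

text \<open>Division by the ideal. The leading monomial either is standard and is kept, or is cancelled by an
  element of the ideal with the same leading monomial; the recursion ends because below a monomial
  there are only finitely many others, all of at most its degree.\<close>

lemma normal_form_below:
  fixes I :: "('v::finite, 'a::field) mpoly set"
  assumes ord: "graded_monomial_order prec" and I: "ring_ideal.subspace I"
  shows "(\<And>b. b \<in> keys h \<Longrightarrow> b = a \<or> prec b a) \<Longrightarrow>
    \<exists>f\<in>standard_span prec I. h - f \<in> I \<and> (\<forall>b\<in>keys f. b = a \<or> prec b a)"
proof (induction "card {b. prec b a}" arbitrary: a h rule: less_induct)
  case less
  have mo: "monomial_order prec" using ord by (simp add: graded_monomial_order_def)
  note irr = monomial_order_irrefl[OF mo] and trans = monomial_order_trans[OF mo]
  have fin: "finite {b. prec b a}"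
  proof (rule finite_subset[OF _ finite_mon_deg_le[of "mon_deg a"]])
    have "mon_deg b \<le> mon_deg a" if "prec b a" for b
    proof (rule ccontr)
      assume "\<not> mon_deg b \<le> mon_deg a"
      then have "prec a b" using ord by (simp add: graded_monomial_order_def)
      then show False using that trans irr by blast
    qed
    then show "{b. prec b a} \<subseteq> {b. mon_deg b \<le> mon_deg a}" by blast
  qed
  obtain t where t: "t \<in> standard_span prec I \<or> t \<in> I" "lookup t a = lookup h a"
    "\<And>b. b \<in> keys t \<Longrightarrow> b = a \<or> prec b a"
  proof (cases "standard_mon prec I a")
    case True
    have "Poly_Mapping.single a (lookup h a) \<in> standard_span prec I"
      using True by (auto simp: standard_span_iff)
    then show ?thesis by (intro that[of "Poly_Mapping.single a (lookup h a)"]) (auto split: if_splits)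
  next
    case False
    from not_standard_witness[OF mo I False] obtain g where g: "g \<in> I" "lookup g a = 1"
      "\<And>b. b \<in> keys g \<Longrightarrow> b = a \<or> prec b a" by blast
    show ?thesis
      by (rule that[of "scale (lookup h a) g"])
         (auto simp: lookup_scale in_keys_iff g(2) ideal_scale[OF I g(1)] dest: g(3)[unfolded in_keys_iff])
  qed
  define h' where "h' = h - t"
  have h'_keys: "prec b a" if "b \<in> keys h'" for b
  proof -
    have "b \<noteq> a" using that t(2) by (auto simp: h'_def in_keys_iff lookup_minus)
    moreover have "b \<in> keys h \<or> b \<in> keys t"
      using that by (auto simp: h'_def in_keys_iff lookup_minus)
    ultimately show ?thesis using less.prems t(3) by blast
  qed
  have "\<exists>f'\<in>standard_span prec I. h' - f' \<in> I \<and> (\<forall>b\<in>keys f'. b = a \<or> prec b a)"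
  proof (cases "h' = 0")
    case True
    then show ?thesis
      using ring_ideal.subspace_0[OF I] mpoly.subspace_0[OF subspace_standard_span]
      by (intro bexI[of _ 0]) auto
  next
    case False
    let ?a' = "lead_mon prec h'"
    have "prec ?a' a" using lead_mon_in_keys[OF mo False] h'_keys by blast
    then have sub: "{b. prec b ?a'} \<subset> {b. prec b a}" using trans irr by blast
    then have "card {b. prec b ?a'} < card {b. prec b a}" by (rule psubset_card_mono[OF fin])
    moreover have "b = ?a' \<or> prec b ?a'" if "b \<in> keys h'" for b
      using lead_mon_greatest[OF mo False that] by blast
    ultimately obtain f' where "f' \<in> standard_span prec I" "h' - f' \<in> I"
      "\<forall>b\<in>keys f'. b = ?a' \<or> prec b ?a'" using less.hyps by blast
    moreover from this(3) have "\<forall>b\<in>keys f'. b = a \<or> prec b a"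
      using \<open>prec ?a' a\<close> trans[of _ ?a' a] by auto
    ultimately show ?thesis by blast
  qed
  then obtain f' where f': "f' \<in> standard_span prec I" "h' - f' \<in> I"
    "\<And>b. b \<in> keys f' \<Longrightarrow> b = a \<or> prec b a" by blast
  from t(1) show ?case
  proof
    assume "t \<in> standard_span prec I"
    then have "f' + t \<in> standard_span prec I"
      using f'(1) mpoly.subspace_add[OF subspace_standard_span] by blast
    moreover have "h - (f' + t) \<in> I" using f'(2) by (simp add: h'_def algebra_simps)
    moreover have "\<forall>b\<in>keys (f' + t). b = a \<or> prec b a" using keys_add[of f' t] f'(3) t(3) by blast
    ultimately show ?thesis by blast
  next
    assume "t \<in> I"
    then have "(h' - f') + t \<in> I" using f'(2) ring_ideal.subspace_add[OF I] by blast
    then have "h - f' \<in> I" by (simp add: h'_def algebra_simps)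
    then show ?thesis using f' by blast
  qed
qed

lemma normal_form:
  fixes I :: "('v::finite, 'a::field) mpoly set"
  assumes ord: "graded_monomial_order prec" and I: "ring_ideal.subspace I" and h: "h \<in> polys_le d"
  obtains f where "f \<in> standard_span prec I" "f \<in> polys_le d" "h - f \<in> I"
proof (cases "h = 0")
  case True
  then show ?thesis
    using that[of 0] ring_ideal.subspace_0[OF I] mpoly.subspace_0[OF subspace_standard_span]
      mpoly.subspace_0[OF subspace_polys_le] by auto
next
  case False
  have mo: "monomial_order prec" using ord by (simp add: graded_monomial_order_def)
  let ?a = "lead_mon prec h"
  have "b = ?a \<or> prec b ?a" if "b \<in> keys h" for b using lead_mon_greatest[OF mo False that] by blast
  from normal_form_below[OF ord I this] obtain f where f: "f \<in> standard_span prec I" "h - f \<in> I"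
    "\<forall>b\<in>keys f. b = ?a \<or> prec b ?a" by blast
  have "mon_deg b \<le> mon_deg ?a" if "b = ?a \<or> prec b ?a" for b
  proof (rule ccontr)
    assume *: "\<not> mon_deg b \<le> mon_deg ?a"
    then have "prec ?a b" using ord by (simp add: graded_monomial_order_def)
    moreover have "prec b ?a" using that * by auto
    ultimately show False using monomial_order_trans[OF mo] monomial_order_irrefl[OF mo] by blast
  qed
  moreover have "int (mon_deg ?a) \<le> d"
    using lead_mon_in_keys[OF mo False] h by (auto simp: polys_le_def)
  ultimately have "f \<in> polys_le d" using f(3) unfolding polys_le_def by force
  then show ?thesis using that f by blast
qed

text \<open>The standard monomials of degree at most \<open>d\<close>: they span by \<open>normal_form\<close>, which does not raise the
  degree, and they are independent by \<open>standard_span_Int_ideal\<close>.\<close>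

lemma standard_monomials_basis:
  fixes I :: "('v::finite, 'a::field) mpoly set" and prec :: "'v mon \<Rightarrow> 'v mon \<Rightarrow> bool"
  assumes ord: "graded_monomial_order prec" and I: "ring_ideal.subspace I"
  shows "\<exists>B. basis_modulo (polys_le d) (I \<inter> polys_le d) B"
proof -
  have mo: "monomial_order prec" using ord by (simp add: graded_monomial_order_def)
  define A where "A = {a :: 'v mon. standard_mon prec I a \<and> int (mon_deg a) \<le> d}"
  let ?m = "\<lambda>a. Poly_Mapping.single a (1::'a) :: ('v, 'a) mpoly"
  have finA: "finite A"
    by (rule finite_subset[OF _ finite_mon_deg_le[of "nat d"]]) (auto simp: A_def)
  have inj: "inj_on ?m A"
  proof (rule inj_onI)
    fix a b :: "'v mon" assume "?m a = ?m b"
    then have "keys (?m a) = keys (?m b)" by simp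
    then show "a = b" by simp
  qed
  have sum: "(\<Sum>b\<in>?m ` A. scale (c b) b) = (\<Sum>a\<in>A. Poly_Mapping.single a (c (?m a)))" for c
    unfolding sum.reindex[OF inj] by (simp add: scale_def mult_single)
  have "basis_modulo (polys_le d) (I \<inter> polys_le d) (?m ` A)"
    unfolding basis_modulo_def
  proof (intro conjI ballI allI impI)
    show "finite (?m ` A)" using finA by simp
    show "?m ` A \<subseteq> polys_le d" by (auto simp: A_def intro: single_polys_le)
  next
    fix h :: "('v, 'a) mpoly" assume h: "h \<in> polys_le d"
    from normal_form[OF ord I h] obtain f where
      f: "f \<in> standard_span prec I" "f \<in> polys_le d" "h - f \<in> I" .
    define c where "c b = lookup f (the_elem (keys b))" for b :: "('v, 'a) mpoly"
    have "(\<Sum>b\<in>?m ` A. scale (c b) b) = (\<Sum>a\<in>A. Poly_Mapping.single a (lookup f a))"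
      by (simp add: sum c_def)
    also have "\<dots> = (\<Sum>a\<in>keys f. Poly_Mapping.single a (lookup f a))"
      using f finA by (intro sum.mono_neutral_right) (auto simp: A_def standard_span_iff polys_le_def in_keys_iff)
    also have "\<dots> = f" using mpoly_eq_sum[of f] by simp
    finally have "h - (\<Sum>b\<in>?m ` A. scale (c b) b) \<in> I \<inter> polys_le d"
      using f h mpoly.subspace_diff[OF subspace_polys_le] by auto
    then show "\<exists>c. h - (\<Sum>b\<in>?m ` A. scale (c b) b) \<in> I \<inter> polys_le d" by (rule exI[of _ c])
  next
    fix c b assume z: "(\<Sum>b\<in>?m ` A. scale (c b) b) \<in> I \<inter> polys_le d" and "b \<in> ?m ` A"
    let ?f = "\<Sum>a\<in>A. Poly_Mapping.single a (c (?m a))"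
    obtain a where a: "a \<in> A" "b = ?m a" using \<open>b \<in> ?m ` A\<close> by blast
    have look: "lookup ?f a' = (if a' \<in> A then c (?m a') else 0)" for a'
      using finA by (simp add: lookup_sum lookup_single when_def)
    have "a' \<in> A" if "a' \<in> keys ?f" for a'
      using look[of a'] that by (auto simp only: in_keys_iff split: if_splits)
    moreover have "standard_mon prec I a'" if "a' \<in> A" for a' using that by (simp add: A_def)
    ultimately have "?f \<in> standard_span prec I" unfolding standard_span_iff by blast
    moreover have "?f \<in> I" using z unfolding sum by blast
    ultimately have "?f = 0" by (rule standard_span_Int_ideal[OF mo])
    then show "c b = 0" using look[of a] a by simp
  qed
  then show ?thesis by blast
qed

section \<open>Values of polynomials at the points\<close>

locale evaluation_points =
  fixes P :: "nat \<Rightarrow> 'v::finite \<Rightarrow> 'a::{field, finite}" and m :: nat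
  assumes inj_P: "inj_on P {..<m}"
begin

abbreviation I :: "('v, 'a) mpoly set" where
  "I \<equiv> vanishing_ideal (P ` {..<m})"

text \<open>The vector \<open>w\<close>, of which only the entries below \<open>m\<close> count, belongs to the code of degree \<open>d\<close>.\<close>

definition attained :: "int \<Rightarrow> (nat \<Rightarrow> 'a) \<Rightarrow> bool" where
  "attained d w \<longleftrightarrow> (\<exists>f\<in>polys_le d. \<forall>i<m. peval f (P i) = w i)"

lemma mem_I_iff: "f \<in> I \<longleftrightarrow> (\<forall>i<m. peval f (P i) = 0)"
  by (auto simp: vanishing_ideal_def)

lemma ideal_I: "ring_ideal.subspace I"
  by (rule subspace_vanishing_ideal)

lemma attainedI: "f \<in> polys_le d \<Longrightarrow> (\<And>i. i < m \<Longrightarrow> peval f (P i) = w i) \<Longrightarrow> attained d w"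
  unfolding attained_def by blast

lemma attainedE:
  assumes "attained d w"
  obtains f where "f \<in> polys_le d" "\<forall>i<m. peval f (P i) = w i"
  using assms unfolding attained_def by blast

lemma attained_cong:
  "attained d v \<Longrightarrow> (\<And>i. i < m \<Longrightarrow> v i = w i) \<Longrightarrow> attained d w"
  unfolding attained_def by auto

lemma attained_mono: "attained d w \<Longrightarrow> d \<le> e \<Longrightarrow> attained e w"
  unfolding attained_def using polys_le_mono[of d e] by blast

lemma attained_add: "attained d v \<Longrightarrow> attained d w \<Longrightarrow> attained d (\<lambda>i. v i + w i)"
  unfolding attained_def
  by (metis peval_add mpoly.subspace_add[OF subspace_polys_le])

lemma attained_smult: "attained d v \<Longrightarrow> attained d (\<lambda>i. c * v i)"
  unfolding attained_def
  by (metis peval_scale mpoly.subspace_scale[OF subspace_polys_le])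

lemma attained_zero: "attained d (\<lambda>_. 0)"
  using mpoly.subspace_0[OF subspace_polys_le] by (intro attainedI[of 0]) (auto simp: peval_zero)

lemma attained_sum:
  "(\<And>k. k \<in> A \<Longrightarrow> attained d (w k)) \<Longrightarrow> attained d (\<lambda>i. \<Sum>k\<in>A. w k i)"
  by (induction A rule: infinite_finite_induct) (simp_all add: attained_zero attained_add)

lemma attained_neg: "d < 0 \<Longrightarrow> attained d w \<longleftrightarrow> (\<forall>i<m. w i = 0)"
  by (auto simp: attained_def polys_le_neg peval_zero)

lemma separating_polynomial:
  assumes "i < m"
  shows "\<exists>f. \<forall>j<m. peval f (P j) = (if j = i then 1 else 0)"
proof -
  have "\<exists>l. peval l (P i) = 1 \<and> peval l (P j) = 0" if j: "j < m" "j \<noteq> i" for j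
  proof -
    have "P i \<noteq> P j" using inj_onD[OF inj_P, of i j] assms j by auto
    then obtain k where k: "P i k \<noteq> P j k" by auto
    let ?l = "scale (1 / (P i k - P j k)) (var k - Poly_Mapping.single 0 (P j k))"
    have "peval ?l (P i) = 1 \<and> peval ?l (P j) = 0"
      using k by (simp add: peval_scale peval_diff peval_var peval_const)
    then show ?thesis ..
  qed
  then obtain l where l: "\<And>j. j < m \<Longrightarrow> j \<noteq> i \<Longrightarrow> peval (l j) (P i) = 1 \<and> peval (l j) (P j) = 0"
    by metis
  have "peval (\<Prod>j\<in>{..<m} - {i}. l j) (P j') = (if j' = i then 1 else 0)" if "j' < m" for j'
    unfolding peval_prod using l that by auto
  then show ?thesis by blast
qed

lemma all_attained_in_high_degree: "\<exists>N::nat. \<forall>d\<ge>int N. \<forall>w. attained d w"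
proof -
  obtain f where f: "\<And>i j. i < m \<Longrightarrow> j < m \<Longrightarrow> peval (f i) (P j) = (if j = i then 1 else 0)"
    using separating_polynomial by metis
  define N where "N = Max (insert 0 (total_deg ` f ` {..<m}))"
  have "attained d w" if d: "d \<ge> int N" for d w
  proof (rule attainedI)
    have "f i \<in> polys_le d" if "i < m" for i
    proof -
      have "total_deg (f i) \<le> N" unfolding N_def using that by (intro Max_ge) auto
      then show ?thesis
        using polys_le_total_deg[of "f i"] polys_le_mono[of "int (total_deg (f i))" d] d by auto
    qed
    then show "(\<Sum>i<m. scale (w i) (f i)) \<in> polys_le d"
      by (intro mpoly.subspace_sum[OF subspace_polys_le] mpoly.subspace_scale[OF subspace_polys_le]) auto
    show "peval (\<Sum>i<m. scale (w i) (f i)) (P j) = w j" if "j < m" for j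
    proof -
      have "peval (\<Sum>i<m. scale (w i) (f i)) (P j) = (\<Sum>i<m. if i = j then w i else 0)"
        unfolding peval_sum peval_scale using f that by (intro sum.cong) auto
      then show ?thesis using that by simp
    qed
  qed
  then show ?thesis by blast
qed

text \<open>The code of degree \<open>d\<close> as a finite set, with the default value beyond \<open>m\<close>, so that it can be counted.\<close>

definition value_tuples :: "int \<Rightarrow> (nat \<Rightarrow> 'a) set" where
  "value_tuples d = (\<lambda>f. restrict (\<lambda>i. peval f (P i)) {..<m}) ` polys_le d"

text \<open>Over a finite field the size of a basis can be read off from the number of elements of the space, and
  the linear combinations of \<open>B\<close> are in bijection with the value vectors.\<close>

lemma card_value_tuples_basis:
  assumes "basis_modulo (polys_le d) (I \<inter> polys_le d) B"
  shows "card (value_tuples d) = card (UNIV :: 'a set) ^ card B"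
proof -
  have fin: "finite B" and B: "B \<subseteq> polys_le d"
    and span: "\<And>f. f \<in> polys_le d \<Longrightarrow> \<exists>c. f - (\<Sum>b\<in>B. scale (c b) b) \<in> I \<inter> polys_le d"
    and ind: "\<And>c b. (\<Sum>b\<in>B. scale (c b) b) \<in> I \<inter> polys_le d \<Longrightarrow> b \<in> B \<Longrightarrow> c b = 0"
    using assms unfolding basis_modulo_def by blast+
  let ?comb = "\<lambda>c. \<Sum>b\<in>B. scale (c b) b"
  let ?ev = "\<lambda>f. restrict (\<lambda>i. peval f (P i)) {..<m}"
  have comb: "?comb c \<in> polys_le d" for c
    using B by (intro mpoly.subspace_sum[OF subspace_polys_le] mpoly.subspace_scale[OF subspace_polys_le]) auto
  have ev_eq: "?ev f = ?ev g \<longleftrightarrow> f - g \<in> I" for f g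
  proof
    assume eq: "?ev f = ?ev g"
    have "peval f (P i) = peval g (P i)" if "i < m" for i using fun_cong[OF eq, of i] that by simp
    then show "f - g \<in> I" by (simp add: mem_I_iff peval_diff)
  qed (auto simp: mem_I_iff peval_diff restrict_def)
  have "bij_betw (\<lambda>c. ?ev (?comb c)) (PiE B (\<lambda>_. UNIV)) (value_tuples d)"
    unfolding bij_betw_def
  proof
    show "inj_on (\<lambda>c. ?ev (?comb c)) (PiE B (\<lambda>_. UNIV))"
    proof (rule inj_onI)
      fix c c' assume c: "c \<in> PiE B (\<lambda>_. UNIV)" "c' \<in> PiE B (\<lambda>_. UNIV)"
        and "?ev (?comb c) = ?ev (?comb c')"
      then have "?comb c - ?comb c' \<in> I \<inter> polys_le d"
        using ev_eq comb mpoly.subspace_diff[OF subspace_polys_le] by blast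
      moreover have "?comb c - ?comb c' = ?comb (\<lambda>b. c b - c' b)"
        by (simp add: mpoly.scale_left_diff_distrib sum_subtractf)
      ultimately have "?comb (\<lambda>b. c b - c' b) \<in> I \<inter> polys_le d" by simp
      from ind[OF this] have "c b = c' b" if "b \<in> B" for b using that by simp
      then show "c = c'" by (rule PiE_ext[OF c])
    qed
    show "(\<lambda>c. ?ev (?comb c)) ` PiE B (\<lambda>_. UNIV) = value_tuples d"
    proof
      show "(\<lambda>c. ?ev (?comb c)) ` PiE B (\<lambda>_. UNIV) \<subseteq> value_tuples d"
        unfolding value_tuples_def using comb by blast
      show "value_tuples d \<subseteq> (\<lambda>c. ?ev (?comb c)) ` PiE B (\<lambda>_. UNIV)"
      proof
        fix w assume "w \<in> value_tuples d"
        then obtain f where f: "f \<in> polys_le d" "w = ?ev f" unfolding value_tuples_def by blast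
        from span[OF f(1)] obtain c where "f - ?comb c \<in> I" by blast
        then have "f - ?comb (restrict c B) \<in> I" by simp
        then have "w = ?ev (?comb (restrict c B))" unfolding f(2) by (rule iffD2[OF ev_eq])
        then show "w \<in> (\<lambda>c. ?ev (?comb c)) ` PiE B (\<lambda>_. UNIV)"
          by (rule image_eqI[of _ _ "restrict c B"]) simp
      qed
    qed
  qed
  from bij_betw_same_card[OF this]
  have "card (value_tuples d) = card (PiE B (\<lambda>_. UNIV :: 'a set))" by (rule sym)
  also have "\<dots> = card (UNIV :: 'a set) ^ card B" using fin by (simp add: card_PiE)
  finally show ?thesis .
qed

lemma card_scalars: "1 < card (UNIV :: 'a set)"
proof -
  have "card {0, 1 :: 'a} \<le> card (UNIV :: 'a set)" by (intro card_mono) auto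
  then show ?thesis by simp
qed

text \<open>The number of elements does not depend on the basis, so all bases have the same size, and this size
  is the value of the affine Hilbert function.\<close>

lemma card_value_tuples:
  assumes "graded_monomial_order (prec :: 'v mon \<Rightarrow> 'v mon \<Rightarrow> bool)"
  shows "card (value_tuples d) = card (UNIV :: 'a set) ^ affine_hilbert I d"
proof -
  obtain B where B: "basis_modulo (polys_le d) (I \<inter> polys_le d) B"
    using standard_monomials_basis[OF assms ideal_I] by blast
  have "card B' = card B" if "basis_modulo (polys_le d) (I \<inter> polys_le d) B'" for B'
    using card_value_tuples_basis[OF that] card_value_tuples_basis[OF B] card_scalars
    by (simp add: power_inject_exp)
  note unique = this
  have "affine_hilbert I d = card B"
    unfolding affine_hilbert_def quot_dim_def
  proof (rule the_equality)
    show "\<exists>B'. basis_modulo (polys_le d) (I \<inter> polys_le d) B' \<and> card B' = card B" using B by blast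
  qed (use unique in blast)
  then show ?thesis using card_value_tuples_basis[OF B] by simp
qed

lemma affine_hilbert_full_iff:
  assumes "graded_monomial_order (prec :: 'v mon \<Rightarrow> 'v mon \<Rightarrow> bool)"
  shows "affine_hilbert I d = m \<longleftrightarrow> (\<forall>w. attained d w)"
proof -
  let ?all = "PiE {..<m} (\<lambda>_. UNIV :: 'a set)"
  \<comment> \<open>Let \<open>q\<close> be the size of the field. The code has \<open>q ^ H(d)\<close> elements, and there are
    \<open>q ^ m\<close> vectors.\<close>
  have sub: "value_tuples d \<subseteq> ?all" unfolding value_tuples_def by (rule image_subsetI) simp
  have all: "finite ?all" "card ?all = card (UNIV :: 'a set) ^ m"
    by (auto simp: card_PiE intro: finite_PiE)
  have "affine_hilbert I d = m \<longleftrightarrow> card (value_tuples d) = card ?all"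
    unfolding card_value_tuples[OF assms] all using card_scalars by (simp add: power_inject_exp)
  also have "\<dots> \<longleftrightarrow> value_tuples d = ?all"
    using card_subset_eq[OF all(1) sub] by auto
  also have "\<dots> \<longleftrightarrow> (\<forall>w. attained d w)"
  proof
    assume eq: "value_tuples d = ?all"
    show "\<forall>w. attained d w"
    proof
      fix w
      have "restrict w {..<m} \<in> value_tuples d" unfolding eq by auto
      then obtain f where f: "f \<in> polys_le d"
        and e: "restrict w {..<m} = restrict (\<lambda>i. peval f (P i)) {..<m}"
        unfolding value_tuples_def by blast
      show "attained d w"
        using f fun_cong[OF e] by (intro attainedI[OF f]) (metis lessThan_iff restrict_apply')
    qed
  next
    assume *: "\<forall>w. attained d w"
    show "value_tuples d = ?all"
    proof (rule subset_antisym[OF sub subsetI])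
      fix w assume w: "w \<in> ?all"
      obtain f where f: "f \<in> polys_le d" "\<forall>i<m. peval f (P i) = w i"
        by (rule attainedE[OF *[rule_format, of w]])
      have "w = restrict (\<lambda>i. peval f (P i)) {..<m}"
        using w f(2) by (intro PiE_ext[OF w]) auto
      then show "w \<in> value_tuples d" unfolding value_tuples_def using f(1) by blast
    qed
  qed
  finally show ?thesis .
qed

text \<open>The codes increase with \<open>d\<close>, so the regularity index \<open>r\<close> is the first degree in which the code is
  everything. For \<open>r = 0\<close> the code of degree \<open>-1\<close> is zero, and thus proper because there is a point.\<close>

lemma regularity_index_props:
  assumes "graded_monomial_order (prec :: 'v mon \<Rightarrow> 'v mon \<Rightarrow> bool)" and "0 < m"
  defines "r \<equiv> regularity_index (P ` {..<m})"
  shows attained_regularity_index: "attained (int r) w"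
    and not_attained_below: "\<exists>w. \<not> attained (int r - 1) w"
proof -
  let ?full = "\<lambda>l::nat. \<forall>d\<ge>l. \<forall>w. attained (int d) w"
  have card: "card (P ` {..<m}) = m" using card_image[OF inj_P] by simp
  have r: "r = (LEAST l. ?full l)"
    unfolding r_def regularity_index_def card affine_hilbert_full_iff[OF assms(1)] ..
  obtain N :: nat where "\<forall>d\<ge>int N. \<forall>w. attained d w"
    using all_attained_in_high_degree by blast
  then have "?full N" by simp
  then have full: "?full r" unfolding r by (rule LeastI)
  then show "attained (int r) w" by blast
  show "\<exists>w. \<not> attained (int r - 1) w"
  proof (rule ccontr)
    assume "\<nexists>w. \<not> attained (int r - 1) w"
    then have all: "\<And>w. attained (int r - 1) w" by blast
    show False
    proof (cases r)
      case 0
      then show False using all[of "\<lambda>_. 1"] \<open>0 < m\<close> by (simp add: attained_neg)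
    next
      case (Suc k)
      have "attained (int d) w" if "k \<le> d" for d w
        using attained_mono[OF all, of "int d" w] that Suc by simp
      then have "?full k" by blast
      then have "r \<le> k" unfolding r by (rule Least_le)
      then show False using Suc by simp
    qed
  qed
qed

end

section \<open>Duality of values for Gorenstein point sets\<close>

locale gorenstein_points = evaluation_points P m
  for P :: "nat \<Rightarrow> 'v::finite \<Rightarrow> 'a::{field, finite}" and m :: nat +
  fixes prec :: "'v mon \<Rightarrow> 'v mon \<Rightarrow> bool"
  assumes ord: "graded_monomial_order prec"
    and gor: "gorenstein_affine (vanishing_ideal (P ` {..<m}))"
    and m_pos: "0 < m"
begin

abbreviation r :: nat where "r \<equiv> regularity_index (P ` {..<m})"

lemma attained_from_r: "int r \<le> d \<Longrightarrow> attained d w"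
  by (rule attained_mono[OF attained_regularity_index[OF ord m_pos]])

lemma attained_values_iff:
  "attained d (\<lambda>i. peval f (P i)) \<longleftrightarrow> (\<exists>h\<in>polys_le d. f - h \<in> I)"
proof -
  have "f - h \<in> I \<longleftrightarrow> (\<forall>i<m. peval h (P i) = peval f (P i))" for h
    by (auto simp: mem_I_iff peval_diff)
  then show ?thesis by (simp add: attained_def)
qed

text \<open>In terms of values, \<open>f\<close> represents a socle element of degree \<open>d\<close> if the values of all \<open>t\<^sub>j f\<close> are
  attained in degree \<open>d\<close>, and it represents zero if its values are attained in degree \<open>d - 1\<close>.\<close>

lemma socle_relation_values:
  assumes f: "f \<in> polys_le (int d)" "\<And>j. attained (int d) (\<lambda>i. P i j * peval f (P i))"
    and g: "g \<in> polys_le (int e)" "\<And>j. attained (int e) (\<lambda>i. P i j * peval g (P i))"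
  shows "\<exists>c c'. (c \<noteq> 0 \<or> c' \<noteq> 0) \<and>
    attained (int d - 1) (\<lambda>i. c * peval f (P i) + (if e = d then c' * peval g (P i) else 0)) \<and>
    attained (int e - 1) (\<lambda>i. (if d = e then c * peval f (P i) else 0) + c' * peval g (P i))"
proof -
  have soc: "\<exists>h\<in>polys_le (int n). var j * q - h \<in> I"
    if "\<And>j. attained (int n) (\<lambda>i. P i j * peval q (P i))" for q n j
    using that[of j] attained_values_iff[of "int n" "var j * q"] by (simp add: peval_mult peval_var)
  obtain c c' where c: "c \<noteq> 0 \<or> c' \<noteq> 0"
    and 1: "\<exists>h\<in>polys_le (int d - 1). scale c f + (if e = d then scale c' g else 0) - h \<in> I"
    and 2: "\<exists>h\<in>polys_le (int e - 1). (if d = e then scale c f else 0) + scale c' g - h \<in> I"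
    using affine_socle_relation[OF ideal_I gor f(1) soc[OF f(2)] g(1) soc[OF g(2)]] by blast
  have "attained (int d - 1) (\<lambda>i. c * peval f (P i) + (if e = d then c' * peval g (P i) else 0))"
    using 1 unfolding attained_values_iff[symmetric]
    by (rule attained_cong) (simp add: peval_add peval_scale peval_zero)
  moreover have "attained (int e - 1) (\<lambda>i. (if d = e then c * peval f (P i) else 0) + c' * peval g (P i))"
    using 2 unfolding attained_values_iff[symmetric]
    by (rule attained_cong) (simp add: peval_add peval_scale peval_zero)
  ultimately show ?thesis using c by blast
qed

text \<open>In degree \<open>r\<close> everything is in the socle, so \<open>C(r) / C(r - 1)\<close> has dimension at most one.\<close>

lemma top_relation: "\<exists>c c'. (c \<noteq> 0 \<or> c' \<noteq> 0) \<and> attained (int r - 1) (\<lambda>i. c * v i + c' * w i)"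
proof -
  obtain f where f: "f \<in> polys_le (int r)" "\<forall>i<m. peval f (P i) = v i"
    by (rule attainedE[OF attained_from_r[OF order_refl, of v]])
  obtain g where g: "g \<in> polys_le (int r)" "\<forall>i<m. peval g (P i) = w i"
    by (rule attainedE[OF attained_from_r[OF order_refl, of w]])
  obtain c c' where c: "c \<noteq> 0 \<or> c' \<noteq> 0"
    and "attained (int r - 1) (\<lambda>i. c * peval f (P i) + c' * peval g (P i))"
    using socle_relation_values[OF f(1) attained_from_r[OF order_refl] g(1) attained_from_r[OF order_refl]]
    by auto
  then have "attained (int r - 1) (\<lambda>i. c * v i + c' * w i)"
    by (elim attained_cong) (simp add: f(2) g(2))
  with c show ?thesis by blast
qed

text \<open>A socle element of degree \<open>d < r\<close> is dependent on one of degree \<open>r\<close> that is not zero, and a linear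
  relation between elements of different degrees holds for each of them separately.\<close>

lemma socle_below_top:
  assumes "d < r" "f \<in> polys_le (int d)" "\<And>j. attained (int d) (\<lambda>i. P i j * peval f (P i))"
  shows "attained (int d - 1) (\<lambda>i. peval f (P i))"
proof -
  obtain t where t: "\<not> attained (int r - 1) t" using not_attained_below[OF ord m_pos] by blast
  obtain g where g: "g \<in> polys_le (int r)" "\<forall>i<m. peval g (P i) = t i"
    by (rule attainedE[OF attained_from_r[OF order_refl, of t]])
  obtain c c' where c: "c \<noteq> 0 \<or> c' \<noteq> 0"
    and 1: "attained (int d - 1) (\<lambda>i. c * peval f (P i))"
    and 2: "attained (int r - 1) (\<lambda>i. c' * peval g (P i))"
    using socle_relation_values[OF assms(2,3) g(1) attained_from_r[OF order_refl]] assms(1) by auto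
  have "c' = 0"
  proof (rule ccontr)
    assume "c' \<noteq> 0"
    then have "attained (int r - 1) t"
      by (intro attained_cong[OF attained_smult[OF 2, of "1 / c'"]]) (simp add: g(2))
    then show False using t by blast
  qed
  with c have "c \<noteq> 0" by simp
  then show ?thesis by (intro attained_cong[OF attained_smult[OF 1, of "1 / c"]]) simp
qed

definition top_functional :: "(nat \<Rightarrow> 'a) \<Rightarrow> bool" where
  "top_functional \<mu> \<longleftrightarrow> (\<forall>w. attained (int r - 1) w \<longleftrightarrow> (\<Sum>i<m. \<mu> i * w i) = 0)"

lemma top_functional_iff:
  "top_functional \<mu> \<Longrightarrow> attained (int r - 1) w \<longleftrightarrow> (\<Sum>i<m. \<mu> i * w i) = 0"
  by (simp add: top_functional_def)

text \<open>With \<open>t\<close> outside of \<open>C(r - 1)\<close>, each unit vector is congruent to a multiple \<open>\<mu>\<^sub>k t\<close> modulo \<open>C(r - 1)\<close>. Then \<open>w\<close> is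
  congruent to \<open>(\<Sum>\<^sub>k \<mu>\<^sub>k w\<^sub>k) t\<close>, which is in \<open>C(r - 1)\<close> only if the coefficient vanishes.\<close>

lemma top_functional_exists: "\<exists>\<mu>. top_functional \<mu>"
proof -
  obtain t where t: "\<not> attained (int r - 1) t" using not_attained_below[OF ord m_pos] by blast
  define \<delta> :: "nat \<Rightarrow> nat \<Rightarrow> 'a" where "\<delta> k = (\<lambda>i. if i = k then 1 else 0)" for k
  have "\<exists>\<mu>. attained (int r - 1) (\<lambda>i. \<delta> k i - \<mu> * t i)" for k
  proof -
    obtain c c' where c: "c \<noteq> 0 \<or> c' \<noteq> 0" and a: "attained (int r - 1) (\<lambda>i. c * \<delta> k i + c' * t i)"
      using top_relation by blast
    have "c \<noteq> 0"
    proof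
      assume "c = 0"
      then have "attained (int r - 1) t"
        using c by (intro attained_cong[OF attained_smult[OF a, of "1 / c'"]]) simp
      then show False using t by blast
    qed
    then have "attained (int r - 1) (\<lambda>i. \<delta> k i - (- c' / c) * t i)"
      by (intro attained_cong[OF attained_smult[OF a, of "1 / c"]]) (simp add: field_simps)
    then show ?thesis ..
  qed
  then obtain \<mu> where \<mu>: "\<And>k. attained (int r - 1) (\<lambda>i. \<delta> k i - \<mu> k * t i)" by metis
  have diff: "attained (int r - 1) (\<lambda>i. w i - (\<Sum>k<m. \<mu> k * w k) * t i)" for w
  proof -
    have "attained (int r - 1) (\<lambda>i. \<Sum>k<m. w k * (\<delta> k i - \<mu> k * t i))"
      using \<mu> by (intro attained_sum attained_smult)
    then show ?thesis
    proof (rule attained_cong)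
      fix i assume "i < m"
      then have "(\<Sum>k<m. w k * \<delta> k i) = w i" by (simp add: \<delta>_def if_distrib cong: if_cong)
      then show "(\<Sum>k<m. w k * (\<delta> k i - \<mu> k * t i)) = w i - (\<Sum>k<m. \<mu> k * w k) * t i"
        by (simp add: right_diff_distrib sum_subtractf sum_distrib_left sum_distrib_right ac_simps)
    qed
  qed
  have "attained (int r - 1) w \<longleftrightarrow> (\<Sum>k<m. \<mu> k * w k) = 0" for w
  proof
    let ?s = "\<Sum>k<m. \<mu> k * w k"
    assume w: "attained (int r - 1) w"
    have st: "attained (int r - 1) (\<lambda>i. ?s * t i)"
      using attained_add[OF w attained_smult[OF diff[of w], of "-1"]]
      by (rule attained_cong) simp
    show "?s = 0"
    proof (rule ccontr)
      assume "?s \<noteq> 0"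
      then have "attained (int r - 1) t"
        by (intro attained_cong[OF attained_smult[OF st, of "1 / ?s"]]) simp
      then show False using t by blast
    qed
  next
    assume "(\<Sum>k<m. \<mu> k * w k) = 0"
    then show "attained (int r - 1) w" using diff[of w] by simp
  qed
  then show ?thesis unfolding top_functional_def by blast
qed

lemma least_degree:
  assumes "i < m" "w i \<noteq> 0"
  obtains d where "d \<le> r" "attained (int d) w" "\<not> attained (int d - 1) w"
proof -
  define d where "d = (LEAST d. attained (int d) w)"
  have "d \<le> r" unfolding d_def by (rule Least_le) (rule attained_from_r[OF order_refl])
  moreover have d: "attained (int d) w"
    unfolding d_def by (rule LeastI[of _ r]) (rule attained_from_r[OF order_refl])
  moreover have "\<not> attained (int d - 1) w"
  proof (cases d)
    case 0
    then show ?thesis using assms by (auto simp: attained_neg)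
  next
    case (Suc k)
    then have "\<not> attained (int k) w" using not_less_Least[of k "\<lambda>d. attained (int d) w"] d_def by auto
    then show ?thesis using Suc by simp
  qed
  ultimately show thesis using that by blast
qed

text \<open>Descending induction on \<open>d\<close>. In degree \<open>r\<close> the test polynomial \<open>g = 1\<close> suffices. Below, the condition
  on \<open>f\<close> for \<open>g = t\<^sub>j g'\<close> is the condition on \<open>t\<^sub>j f\<close> for \<open>g'\<close>, so \<open>f\<close> represents a socle element of
  degree \<open>d < r\<close>, which is zero.\<close>

lemma pairing_nondegenerate:
  assumes \<mu>: "top_functional \<mu>"
  shows "d \<le> r \<Longrightarrow> f \<in> polys_le (int d) \<Longrightarrow>
    (\<And>g. g \<in> polys_le (int r - int d) \<Longrightarrow> (\<Sum>i<m. \<mu> i * (peval f (P i) * peval g (P i))) = 0) \<Longrightarrow>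
    attained (int d - 1) (\<lambda>i. peval f (P i))"
proof (induction "r - d" arbitrary: d f)
  case 0
  have "(\<Sum>i<m. \<mu> i * (peval f (P i) * peval 1 (P i))) = 0"
    using 0(1,2) by (intro 0(4)) (simp add: polys_le_def mon_deg_zero)
  then show ?case using 0 by (simp add: top_functional_iff[OF \<mu>] peval_one)
next
  case (Suc k)
  then have "d < r" by simp
  have "attained (int d) (\<lambda>i. P i j * peval f (P i))" for j
  proof -
    have "attained (int (Suc d) - 1) (\<lambda>i. peval (var j * f) (P i))"
    proof (rule Suc.hyps(1))
      show "k = r - Suc d" "Suc d \<le> r" using Suc.hyps(2) by auto
      show "var j * f \<in> polys_le (int (Suc d))"
        using polys_le_mult[OF var_polys_le Suc.prems(2)] by simp
      fix g :: "('v, 'a) mpoly" assume g: "g \<in> polys_le (int r - int (Suc d))"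
      have "var j * g \<in> polys_le (int r - int d)"
        using polys_le_mult[OF var_polys_le g] by simp
      from Suc.prems(3)[OF this]
      show "(\<Sum>i<m. \<mu> i * (peval (var j * f) (P i) * peval g (P i))) = 0"
        by (simp add: peval_mult peval_var ac_simps)
    qed
    then show ?thesis by (simp add: peval_mult peval_var)
  qed
  then show ?case using socle_below_top[OF \<open>d < r\<close> Suc.prems(2)] by blast
qed

text \<open>If \<open>\<mu>\<^sub>k = 0\<close>, the indicator of the \<open>k\<close>-th point pairs to zero with everything, so its degree could always
  be lowered.\<close>

lemma functional_nonzero:
  assumes \<mu>: "top_functional \<mu>" and k: "k < m"
  shows "\<mu> k \<noteq> 0"
proof
  assume 0: "\<mu> k = 0"
  let ?w = "\<lambda>i. if i = k then 1 else 0 :: 'a"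
  have "?w k \<noteq> 0" by simp
  with k obtain d where d: "d \<le> r" "attained (int d) ?w" "\<not> attained (int d - 1) ?w"
    by (rule least_degree)
  obtain f where f: "f \<in> polys_le (int d)" "\<forall>i<m. peval f (P i) = ?w i"
    by (rule attainedE[OF d(2)])
  have "attained (int d - 1) (\<lambda>i. peval f (P i))"
    using d(1) f(1)
  proof (rule pairing_nondegenerate[OF \<mu>])
    show "(\<Sum>i<m. \<mu> i * (peval f (P i) * peval g (P i))) = 0" for g
      using f(2) 0 by (intro sum.neutral) auto
  qed
  then have "attained (int d - 1) ?w" by (rule attained_cong) (simp add: f(2))
  then show False using d(3) by blast
qed

text \<open>From left to right the product of the two polynomials has degree at most \<open>r - 1\<close>, where the
  functional vanishes. From right to left, if the least degree \<open>e\<close> of a polynomial with values \<open>c\<close> were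
  greater than \<open>r - d - 1\<close>, then the test polynomials of degree at most \<open>r - e \<le> d\<close> would be among those
  to which \<open>\<mu> c\<close> is orthogonal, and \<open>e\<close> could be lowered.\<close>

lemma code_duality:
  assumes \<mu>: "top_functional \<mu>"
    and "-1 \<le> d" "d \<le> int r"
  shows "attained (int r - d - 1) c \<longleftrightarrow>
    (\<forall>f\<in>polys_le d. (\<Sum>i<m. \<mu> i * c i * peval f (P i)) = 0)"
proof
  assume c: "attained (int r - d - 1) c"
  obtain h where h: "h \<in> polys_le (int r - d - 1)" "\<forall>i<m. peval h (P i) = c i"
    by (rule attainedE[OF c])
  show "\<forall>f\<in>polys_le d. (\<Sum>i<m. \<mu> i * c i * peval f (P i)) = 0"
  proof
    fix f :: "('v, 'a) mpoly" assume f: "f \<in> polys_le d"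
    have "h * f \<in> polys_le (int r - 1)" using polys_le_mult[OF h(1) f] by simp
    then have "attained (int r - 1) (\<lambda>i. c i * peval f (P i))"
      by (rule attainedI) (simp add: peval_mult h(2))
    then show "(\<Sum>i<m. \<mu> i * c i * peval f (P i)) = 0" by (simp add: top_functional_iff[OF \<mu>] mult.assoc)
  qed
next
  assume perp: "\<forall>f\<in>polys_le d. (\<Sum>i<m. \<mu> i * c i * peval f (P i)) = 0"
  show "attained (int r - d - 1) c"
  proof (cases "\<exists>i<m. c i \<noteq> 0")
    case False
    then show ?thesis using attained_cong[OF attained_zero] by simp
  next
    case True
    then obtain k where "k < m" "c k \<noteq> 0" by blast
    then obtain e where e: "e \<le> r" "attained (int e) c" "\<not> attained (int e - 1) c"
      by (rule least_degree)
    obtain h where h: "h \<in> polys_le (int e)" "\<forall>i<m. peval h (P i) = c i"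
      by (rule attainedE[OF e(2)])
    have "int e \<le> int r - d - 1"
    proof (rule ccontr)
      assume "\<not> int e \<le> int r - d - 1"
      then have le: "int r - int e \<le> d" by simp
      have "attained (int e - 1) (\<lambda>i. peval h (P i))"
        using e(1) h(1)
      proof (rule pairing_nondegenerate[OF \<mu>])
        fix g :: "('v, 'a) mpoly" assume "g \<in> polys_le (int r - int e)"
        then have "g \<in> polys_le d" using polys_le_mono[OF le] by blast
        with perp show "(\<Sum>i<m. \<mu> i * (peval h (P i) * peval g (P i))) = 0"
          by (simp add: h(2) mult.assoc)
      qed
      then have "attained (int e - 1) c" by (rule attained_cong) (simp add: h(2))
      then show False using e(3) by blast
    qed
    then show ?thesis using attained_mono[OF e(2)] by blast
  qed
qed

abbreviation indicator where "indicator i \<equiv> standard_indicator prec P m i"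

lemma mo: "monomial_order prec"
  using ord by (simp add: graded_monomial_order_def)

text \<open>The normal form of any polynomial of degree at most \<open>r\<close> with the prescribed values; two candidates
  differ by an element of the ideal in the standard span, which is zero.\<close>

lemma indicator_props:
  assumes "i < m"
  shows "indicator i \<in> standard_span prec I" "indicator i \<in> polys_le (int r)"
    and "j < m \<Longrightarrow> peval (indicator i) (P j) = (if j = i then 1 else 0)"
proof -
  let ?Q = "\<lambda>f. f \<in> standard_span prec I \<and> peval f (P i) = 1 \<and> (\<forall>j<m. j \<noteq> i \<longrightarrow> peval f (P j) = 0)"
  obtain h where h: "h \<in> polys_le (int r)" "\<forall>j<m. peval h (P j) = (if j = i then 1 else 0)"
    by (rule attainedE[OF attained_from_r[OF order_refl, of "\<lambda>j. if j = i then 1 else 0"]])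
  from normal_form[OF ord ideal_I h(1)] obtain f where
    f: "f \<in> standard_span prec I" "f \<in> polys_le (int r)" "h - f \<in> I" .
  have val: "peval f (P j) = (if j = i then 1 else 0)" if "j < m" for j
    using f(3) h(2) that by (simp add: mem_I_iff peval_diff)
  have "indicator i = f"
    unfolding standard_indicator_def
  proof (rule the_equality)
    show "?Q f" using f(1) val assms by simp
    fix g assume g: "?Q g"
    have "g - f \<in> I" using g val assms by (auto simp: mem_I_iff peval_diff)
    moreover have "g - f \<in> standard_span prec I"
      using g f(1) mpoly.subspace_diff[OF subspace_standard_span] by blast
    ultimately show "g = f" using standard_span_Int_ideal[OF mo, of "g - f"] by simp
  qed
  then show "indicator i \<in> standard_span prec I" "indicator i \<in> polys_le (int r)"
    "j < m \<Longrightarrow> peval (indicator i) (P j) = (if j = i then 1 else 0)"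
    using f val by auto
qed

text \<open>Two standard monomials of degree \<open>r\<close> would be dependent modulo polynomials of lower degree and the
  ideal, against the uniqueness of normal forms.\<close>

lemma unique_top_standard_monomial:
  assumes "standard_mon prec I a" "mon_deg a = r" "standard_mon prec I b" "mon_deg b = r"
  shows "a = b"
proof (rule ccontr)
  assume "a \<noteq> b"
  let ?a = "Poly_Mapping.single a 1 :: ('v, 'a) mpoly" and ?b = "Poly_Mapping.single b 1 :: ('v, 'a) mpoly"
  from top_relation[of "\<lambda>i. peval ?a (P i)" "\<lambda>i. peval ?b (P i)"]
  obtain c c' where c: "c \<noteq> 0 \<or> c' \<noteq> 0"
    and ab: "attained (int r - 1) (\<lambda>i. c * peval ?a (P i) + c' * peval ?b (P i))"
    by (elim exE conjE) (rule that)
  obtain h where h: "h \<in> polys_le (int r - 1)"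
    "\<forall>i<m. peval h (P i) = c * peval ?a (P i) + c' * peval ?b (P i)"
    by (rule attainedE[OF ab])
  from normal_form[OF ord ideal_I h(1)] obtain f where
    f: "f \<in> standard_span prec I" "f \<in> polys_le (int r - 1)" "h - f \<in> I" .
  let ?F = "scale c ?a + scale c' ?b - f"
  have "?a \<in> standard_span prec I" "?b \<in> standard_span prec I"
    using assms by (simp_all add: standard_span_iff)
  then have "?F \<in> standard_span prec I"
    using f(1) subspace_standard_span
    by (intro mpoly.subspace_diff mpoly.subspace_add mpoly.subspace_scale) auto
  moreover have "?F \<in> I"
    using f(3) h(2) by (simp add: mem_I_iff peval_diff peval_add peval_scale)
  ultimately have F: "?F = 0" by (rule standard_span_Int_ideal[OF mo])
  have "a \<notin> keys f" "b \<notin> keys f"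
    using f(2) assms(2,4) by (auto simp: polys_le_def)
  then have "lookup f a = 0" "lookup f b = 0" by (simp_all add: in_keys_iff)
  moreover have "lookup ?F a = 0" "lookup ?F b = 0" unfolding F by simp_all
  ultimately show False
    using c \<open>a \<noteq> b\<close> by (simp add: lookup_minus lookup_add lookup_scale lookup_single)
qed

text \<open>Every indicator has degree \<open>r\<close>, since \<open>\<mu>\<^sub>i \<noteq> 0\<close> means that its values are not in \<open>C(r - 1)\<close>, so its leading
  monomial is the only standard monomial of degree \<open>r\<close>. The combination \<open>lc(f\<^sub>i) f\<^sub>j - lc(f\<^sub>j) f\<^sub>i\<close> lacks
  this monomial, so its values are in \<open>C(r - 1)\<close>, where the functional \<open>\<mu>\<close> vanishes.\<close>

lemma lead_coef_proportional:
  assumes \<mu>: "top_functional \<mu>"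
  shows "\<exists>\<kappa>. \<kappa> \<noteq> 0 \<and> (\<forall>i<m. lead_coef prec (indicator i) = \<kappa> * \<mu> i)"
proof -
  let ?l = "\<lambda>i. lead_mon prec (indicator i)" and ?c = "\<lambda>i. lead_coef prec (indicator i)"
  have nz: "indicator i \<noteq> 0" if "i < m" for i
    using indicator_props(3)[OF that that] by (auto simp: peval_zero)
  have lead: "?l i \<in> keys (indicator i)" if "i < m" for i
    using lead_mon_in_keys[OF mo nz[OF that]] .
  have std: "standard_mon prec I a" if "i < m" "a \<in> keys (indicator i)" for i a
    using indicator_props(1)[OF that(1)] that(2) unfolding standard_span_iff by blast
  have sum: "(\<Sum>i<m. \<mu> i * (if i = k then 1 else 0)) = \<mu> k" if "k < m" for k
    using that by (simp add: if_distrib cong: if_cong)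
  have deg: "mon_deg (?l i) = r" if i: "i < m" for i
  proof (rule antisym)
    show "mon_deg (?l i) \<le> r"
      using indicator_props(2)[OF i] lead[OF i] by (auto simp: polys_le_def)
    show "r \<le> mon_deg (?l i)"
    proof (rule ccontr)
      assume lt: "\<not> r \<le> mon_deg (?l i)"
      have "mon_deg b \<le> mon_deg (?l i)" if "b \<in> keys (indicator i)" for b
      proof (rule ccontr)
        assume "\<not> mon_deg b \<le> mon_deg (?l i)"
        then have "prec (?l i) b" "b \<noteq> ?l i" using ord by (auto simp: graded_monomial_order_def)
        then show False
          using lead_mon_greatest[OF mo nz[OF i] that] monomial_order_trans[OF mo, of b "?l i" b]
            monomial_order_irrefl[OF mo, of b] by blast
      qed
      then have "indicator i \<in> polys_le (int r - 1)" using lt by (force simp: polys_le_def)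
      then have "attained (int r - 1) (\<lambda>j. if j = i then 1 else 0)"
        by (rule attainedI) (rule indicator_props(3)[OF i])
      then show False using functional_nonzero[OF \<mu> i] top_functional_iff[OF \<mu>] sum[OF i] by simp
    qed
  qed
  have lc: "?c i \<noteq> 0" if "i < m" for i
    using lead[OF that] by (simp add: lead_coef_def in_keys_iff)
  have cross: "?c i * \<mu> j = ?c j * \<mu> i" if i: "i < m" and j: "j < m" for i j
  proof -
    have same: "?l j = ?l i"
      using unique_top_standard_monomial[OF std[OF j lead[OF j]] deg[OF j] std[OF i lead[OF i]] deg[OF i]] .
    let ?F = "scale (?c i) (indicator j) - scale (?c j) (indicator i)"
    have "?F \<in> polys_le (int r - 1)"
      unfolding polys_le_def
    proof (intro CollectI ballI)
      fix a assume a: "a \<in> keys ?F"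
      then have a': "a \<in> keys (indicator i) \<or> a \<in> keys (indicator j)"
        by (auto simp: in_keys_iff lookup_minus lookup_scale)
      then have "mon_deg a \<le> r" "standard_mon prec I a"
        using indicator_props(2)[OF i] indicator_props(2)[OF j] std[OF i] std[OF j]
        by (auto simp: polys_le_def)
      moreover have "a \<noteq> ?l i"
      proof
        assume "a = ?l i"
        then have "lookup ?F a = 0"
          using same by (simp add: lookup_minus lookup_scale lead_coef_def mult.commute)
        then show False using a by (simp add: in_keys_iff)
      qed
      ultimately have "mon_deg a \<noteq> r"
        using unique_top_standard_monomial[OF _ _ std[OF i lead[OF i]] deg[OF i]] by blast
      then show "int (mon_deg a) \<le> int r - 1" using \<open>mon_deg a \<le> r\<close> by simp
    qed
    then have "attained (int r - 1) (\<lambda>k. ?c i * (if k = j then 1 else 0) - ?c j * (if k = i then 1 else 0))"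
      by (rule attainedI)
         (simp only: peval_diff peval_scale indicator_props(3)[OF i] indicator_props(3)[OF j])
    then have "(\<Sum>k<m. \<mu> k * (?c i * (if k = j then 1 else 0) - ?c j * (if k = i then 1 else 0))) = 0"
      unfolding top_functional_iff[OF \<mu>] .
    moreover have "(\<Sum>k<m. \<mu> k * (?c i * (if k = j then 1 else 0) - ?c j * (if k = i then 1 else 0)))
      = ?c i * (\<Sum>k<m. \<mu> k * (if k = j then 1 else 0)) - ?c j * (\<Sum>k<m. \<mu> k * (if k = i then 1 else 0))"
      by (simp only: right_diff_distrib sum_subtractf sum_distrib_left mult.left_commute)
    ultimately show ?thesis using sum[OF i] sum[OF j] by simp
  qed
  have \<mu>0: "\<mu> 0 \<noteq> 0" using functional_nonzero[OF \<mu> m_pos] .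
  show ?thesis
  proof (intro exI conjI allI impI)
    show "?c 0 / \<mu> 0 \<noteq> 0" using lc[OF m_pos] \<mu>0 by simp
    show "?c i = ?c 0 / \<mu> 0 * \<mu> i" if "i < m" for i
      using cross[OF m_pos that] \<mu>0 by (simp add: field_simps)
  qed
qed

lemma lead_coef_top_functional: "top_functional (\<lambda>i. lead_coef prec (indicator i))"
proof -
  obtain \<mu> where \<mu>: "top_functional \<mu>" using top_functional_exists by blast
  obtain \<kappa> where \<kappa>: "\<kappa> \<noteq> 0" "\<forall>i<m. lead_coef prec (indicator i) = \<kappa> * \<mu> i"
    using lead_coef_proportional[OF \<mu>] by blast
  have "(\<Sum>i<m. lead_coef prec (indicator i) * w i) = \<kappa> * (\<Sum>i<m. \<mu> i * w i)" for w
    using \<kappa>(2) by (simp add: sum_distrib_left mult.assoc)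
  then show ?thesis using \<mu> \<kappa>(1) by (simp add: top_functional_def)
qed

end

theorem corollary6p15:
  fixes P :: "nat \<Rightarrow> 'v::finite \<Rightarrow> 'a::{field, finite}"
    and m :: nat
    and prec :: "'v mon \<Rightarrow> 'v mon \<Rightarrow> bool"
  defines "X \<equiv> P ` {..<m}"
  defines "I \<equiv> vanishing_ideal X"
  defines "r\<^sub>0 \<equiv> regularity_index X"
  assumes "inj_on P {..<m}" and "card X \<ge> 2"
    and "graded_monomial_order prec"
    and "gorenstein_affine I"
  shows "\<exists>g \<in> standard_span prec I.
           (\<forall>i<m. peval g (P i) \<noteq> 0) \<and>
           (\<forall>d::int. -1 \<le> d \<and> d \<le> int r\<^sub>0 \<longrightarrow>
              scale_code m (\<lambda>i. peval g (P i)) (eval_code P m (int r\<^sub>0 - d - 1)) =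
                dual_code m (eval_code P m d)) \<and>
           g = (\<Sum>i<m. scale (lead_coef prec (standard_indicator prec P m i))
                  (standard_indicator prec P m i))"
proof -
  have "0 < m" using \<open>card X \<ge> 2\<close> unfolding X_def by (cases m) auto
  interpret gorenstein_points P m prec
    using assms \<open>0 < m\<close> unfolding I_def X_def by unfold_locales
  let ?\<beta> = "\<lambda>i. lead_coef prec (standard_indicator prec P m i)"
  define g where "g = (\<Sum>i<m. scale (?\<beta> i) (standard_indicator prec P m i))"
  have g_span: "g \<in> standard_span prec I"
    unfolding g_def I_def X_def
    by (intro mpoly.subspace_sum[OF subspace_standard_span] mpoly.subspace_scale[OF subspace_standard_span])
       (use indicator_props(1) in auto)
  have g_val: "peval g (P j) = ?\<beta> j" if "j < m" for j
  proof -
    have "peval g (P j) = (\<Sum>i<m. ?\<beta> i * (if j = i then 1 else 0))"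
      unfolding g_def peval_sum peval_scale using indicator_props(3) that by (intro sum.cong) auto
    then show ?thesis using that by (simp add: if_distrib cong: if_cong)
  qed
  note nz = functional_nonzero[OF lead_coef_top_functional]
  have dual: "scale_code m (\<lambda>i. peval g (P i)) (eval_code P m (int r\<^sub>0 - d - 1)) =
      dual_code m (eval_code P m d)" if d: "-1 \<le> d" "d \<le> int r\<^sub>0" for d
  proof -
    have duality: "attained (int r\<^sub>0 - d - 1) c \<longleftrightarrow>
        (\<forall>f\<in>polys_le d. (\<Sum>i<m. ?\<beta> i * c i * peval f (P i)) = 0)" for c
      using code_duality[OF lead_coef_top_functional] d unfolding r\<^sub>0_def X_def by blast
    have in_dual: "w \<in> dual_code m (eval_code P m d) \<longleftrightarrow>
        w \<in> carrier_vec m \<and> (\<forall>f\<in>polys_le d. (\<Sum>i<m. w $ i * peval f (P i)) = 0)" for w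
      by (auto simp: dual_code_def eval_code_def scalar_prod_def atLeast0LessThan)
    have in_scaled: "w \<in> scale_code m (\<lambda>i. peval g (P i)) (eval_code P m (int r\<^sub>0 - d - 1)) \<longleftrightarrow>
        (\<exists>c. attained (int r\<^sub>0 - d - 1) c \<and> w = vec m (\<lambda>i. ?\<beta> i * c i))" for w
    proof
      assume "w \<in> scale_code m (\<lambda>i. peval g (P i)) (eval_code P m (int r\<^sub>0 - d - 1))"
      then obtain f where f: "f \<in> polys_le (int r\<^sub>0 - d - 1)"
        and w: "w = vec m (\<lambda>i. peval g (P i) * vec m (\<lambda>i. peval f (P i)) $ i)"
        unfolding scale_code_def eval_code_def by blast
      have "w = vec m (\<lambda>i. ?\<beta> i * peval f (P i))" unfolding w by (intro eq_vecI) (auto simp: g_val)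
      moreover have "attained (int r\<^sub>0 - d - 1) (\<lambda>i. peval f (P i))" using f by (rule attainedI) simp
      ultimately show "\<exists>c. attained (int r\<^sub>0 - d - 1) c \<and> w = vec m (\<lambda>i. ?\<beta> i * c i)" by blast
    next
      assume "\<exists>c. attained (int r\<^sub>0 - d - 1) c \<and> w = vec m (\<lambda>i. ?\<beta> i * c i)"
      then obtain c where c: "attained (int r\<^sub>0 - d - 1) c" and w: "w = vec m (\<lambda>i. ?\<beta> i * c i)"
        by blast
      obtain f where f: "f \<in> polys_le (int r\<^sub>0 - d - 1)" "\<forall>i<m. peval f (P i) = c i"
        by (rule attainedE[OF c])
      have "w = vec m (\<lambda>i. peval g (P i) * vec m (\<lambda>i. peval f (P i)) $ i)"
        unfolding w by (intro eq_vecI) (auto simp: g_val f(2))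
      with f(1) show "w \<in> scale_code m (\<lambda>i. peval g (P i)) (eval_code P m (int r\<^sub>0 - d - 1))"
        unfolding scale_code_def eval_code_def by blast
    qed
    show ?thesis
    proof (intro subset_antisym subsetI)
      fix w assume "w \<in> scale_code m (\<lambda>i. peval g (P i)) (eval_code P m (int r\<^sub>0 - d - 1))"
      then obtain c where "attained (int r\<^sub>0 - d - 1) c" "w = vec m (\<lambda>i. ?\<beta> i * c i)"
        unfolding in_scaled by blast
      then show "w \<in> dual_code m (eval_code P m d)" unfolding in_dual duality by simp
    next
      fix w assume "w \<in> dual_code m (eval_code P m d)"
      then have w: "w \<in> carrier_vec m" "\<forall>f\<in>polys_le d. (\<Sum>i<m. w $ i * peval f (P i)) = 0"
        unfolding in_dual by auto
      let ?c = "\<lambda>i. w $ i / ?\<beta> i"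
      have "attained (int r\<^sub>0 - d - 1) ?c" unfolding duality using w(2) nz by simp
      moreover have "w = vec m (\<lambda>i. ?\<beta> i * ?c i)" using w(1) nz by (intro eq_vecI) auto
      ultimately show "w \<in> scale_code m (\<lambda>i. peval g (P i)) (eval_code P m (int r\<^sub>0 - d - 1))"
        unfolding in_scaled by blast
    qed
  qed
  show ?thesis
    using g_span g_val nz dual by (intro bexI[of _ g] conjI) (auto simp: g_def)
qed

end
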